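(* The function $$Z_{\mathrm{4D}}(\boldsymbol{T})=\sum_{\lambda\in\mathcal{P}}\left(\frac{\dim\lambda}{|\lambda|!}\right)^2\left(\frac{\Lambda}{\hbar}\right)^{2|\lambda|}\exp\Big(\sum_{k=1}^\infty T_k\phi^{\mathrm{4D}}_k(\lambda)\Big),\qquad \phi^{\mathrm{4D}}_k(\lambda)=\sum_{i=1}^\infty\big((\lambda_i-i+1)^k-(-i+1)^k\big),$$ of $\boldsymbol{T}=(T_1,T_2,\ldots)$ is a tau function of the KP hierarchy with time variables $\boldsymbol{T}$.
   Context: $\mathcal{P}$ is the set of all partitions $\lambda=(\lambda_1\ge\lambda_2\ge\cdots\ge0)$ with finitely many nonzero parts, $|\lambda|=\sum_i\lambda_i$, and $\dim\lambda$ is the number of standard Young tableaux of shape $\lambda$; $\hbar\ne0$ and $\Lambda$ are parameters. The sum defining $\phi^{\mathrm{4D}}_k(\lambda)$ has finitely many nonzero terms. $Z_{\mathrm{4D}}(\boldsymbol{T})$ is regarded as a formal power series in $T_1,T_2,\ldots$ with coefficients in formal power series in $\Lambda^2$. KP tau function: a nonzero formal power series $\tau(\boldsymbol{t})$ in $\boldsymbol{t}=(t_1,t_2,\ldots)$ is a tau function of the KP hierarchy if it satisfies the bilinear identity $$\oint\frac{dz}{2\pi i}\,e^{\sum_{k\ge1}(t'_k-t_k)z^k}\,\tau(\boldsymbol{t}'-[z^{-1}])\,\tau(\boldsymbol{t}+[z^{-1}])=0$$ identically in $\boldsymbol{t},\boldsymbol{t}'$, where $\oint\frac{dz}{2\pi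 i}$ means extracting the coefficient of $z^{-1}$ and $[w]=(w,w^2/2,\ldots,w^k/k,\ldots)$. *)

theory Defs
  imports
    "HOL-Analysis.Analysis"
    "HOL-Computational_Algebra.Formal_Laurent_Series"
    "HOL-Library.Poly_Mapping"
begin

section \<open>Formal power series in infinitely many variables\<close>

text \<open>
  A formal power series in \<open>t\<^sub>1, t\<^sub>2, \<dots>\<close> is its coefficient function on multi-indices.
  Multi-indices and all families below are 0-based: position \<open>i\<close> of \<open>\<alpha>\<close> holds the exponent
  of \<open>t\<^bsub>Suc i\<^esub>\<close>, so \<open>\<alpha>\<close> stands for the monomial \<open>\<Prod>i. t\<^bsub>Suc i\<^esub> ^ lookup \<alpha> i\<close>.
\<close>

type_synonym multiindex = "nat \<Rightarrow>\<^sub>0 nat"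

type_synonym 'a series = "multiindex \<Rightarrow> 'a"

text \<open>The weighted degree, where \<open>t\<^sub>k\<close> has weight \<open>k\<close>.\<close>

definition weight :: "multiindex \<Rightarrow> nat" where
  "weight \<alpha> = (\<Sum>i\<in>Poly_Mapping.keys \<alpha>. Suc i * Poly_Mapping.lookup \<alpha> i)"

definition splits :: "multiindex \<Rightarrow> (multiindex \<times> multiindex) set" where
  "splits \<gamma> = {(\<alpha>, \<beta>). \<alpha> + \<beta> = \<gamma>}"

text \<open>The series \<open>exp (\<Sum>i. c i * t\<^bsub>Suc i\<^esub>) = (\<Prod>i. \<Sum>n. c i ^ n * t\<^bsub>Suc i\<^esub> ^ n / n!)\<close>.\<close>

definition exp_linear :: "(nat \<Rightarrow> 'a::field_char_0) \<Rightarrow> 'a series" where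
  "exp_linear c \<alpha> = (\<Prod>i\<in>Poly_Mapping.keys \<alpha>. c i ^ Poly_Mapping.lookup \<alpha> i / fact (Poly_Mapping.lookup \<alpha> i))"


section \<open>Tau functions of the KP hierarchy\<close>

text \<open>
  The variable \<open>z\<close> is handled by formal Laurent series in \<open>z\<^sup>-\<^sup>1\<close>: \<open>fls_X\<close> stands for
  \<open>z\<^sup>-\<^sup>1\<close> and \<open>fls_X_inv\<close> for \<open>z\<close>, so that the coefficient of \<open>z\<^sup>-\<^sup>1\<close> is the one at position 1.
\<close>

text \<open>
  For \<open>e = \<plusminus>1\<close>, the series \<open>\<tau>(t + e [z\<^sup>-\<^sup>1])\<close>, that is the substitution of
  \<open>t\<^sub>k + e z\<^bsup>-k\<^esup> / k\<close> for every \<open>t\<^sub>k\<close>. By the binomial theorem the monomial with multi-index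
  \<open>\<alpha> + \<beta>\<close> contributes to \<open>t\<^bsup>\<alpha>\<^esup>\<close> the term
  \<open>\<Prod>i. (\<alpha>\<^sub>i + \<beta>\<^sub>i choose \<beta>\<^sub>i) (e z\<^bsup>-(i+1)\<^esup> / (i+1))\<^bsup>\<beta>\<^sub>i\<^esup>\<close>, which is a multiple of \<open>z\<^bsup>-m\<^esup>\<close> where
  \<open>m = weight \<beta>\<close>.
\<close>

definition miwa_shift :: "'a::field_char_0 \<Rightarrow> 'a series \<Rightarrow> 'a fls series" where
  "miwa_shift e \<tau> \<alpha> = fps_to_fls (Abs_fps (\<lambda>m. \<Sum>\<beta> | weight \<beta> = m.
     \<tau> (\<alpha> + \<beta>) * (\<Prod>i\<in>Poly_Mapping.keys \<beta>.
       of_nat (Poly_Mapping.lookup (\<alpha> + \<beta>) i choose Poly_Mapping.lookup \<beta> i)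
       * (e / of_nat (Suc i)) ^ Poly_Mapping.lookup \<beta> i)))"

text \<open>
  The coefficient of \<open>t'\<^bsup>\<alpha>\<^esup> t\<^bsup>\<beta>\<^esup>\<close> in
  \<open>exp (\<Sum>k. (t'\<^sub>k - t\<^sub>k) z^k) \<tau>(t' - [z\<^sup>-\<^sup>1]) \<tau>(t + [z\<^sup>-\<^sup>1])\<close>, the exponential being
  \<open>exp (\<Sum>k. t'\<^sub>k z^k) exp (\<Sum>k. - t\<^sub>k z^k)\<close>.
\<close>

definition kp_integrand :: "'a::field_char_0 series \<Rightarrow> multiindex \<Rightarrow> multiindex \<Rightarrow> 'a fls" where
  "kp_integrand \<tau> \<alpha> \<beta> =
     (\<Sum>(\<alpha>1, \<alpha>2)\<in>splits \<alpha>. \<Sum>(\<beta>1, \<beta>2)\<in>splits \<beta>.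
        exp_linear (\<lambda>i. fls_X_inv ^ Suc i) \<alpha>1 * exp_linear (\<lambda>i. - (fls_X_inv ^ Suc i)) \<beta>1
        * miwa_shift (-1) \<tau> \<alpha>2 * miwa_shift 1 \<tau> \<beta>2)"

text \<open>
  Coefficients are taken in a field of characteristic 0, as the identity divides by integers.
  A series with coefficients in \<open>'a fps\<close> is viewed over the fraction field \<open>'a fls\<close> along the
  embedding \<open>fps_to_fls\<close>.
\<close>

definition kp_tau :: "'a::field_char_0 series \<Rightarrow> bool" where
  "kp_tau \<tau> \<longleftrightarrow> (\<exists>\<alpha>. \<tau> \<alpha> \<noteq> 0) \<and> (\<forall>\<alpha> \<beta>. fls_nth (kp_integrand \<tau> \<alpha> \<beta>) 1 = 0)"


section \<open>Partitions and standard Young tableaux\<close>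

text \<open>Parts are 0-based as well: \<open>p i\<close> is the part \<open>\<lambda>\<^bsub>i+1\<^esub>\<close>.\<close>

definition partitions :: "(nat \<Rightarrow> nat) set" where
  "partitions = {p. antimono p \<and> finite {i. p i \<noteq> 0}}"

definition psize :: "(nat \<Rightarrow> nat) \<Rightarrow> nat" where
  "psize p = (\<Sum>i | p i \<noteq> 0. p i)"

definition diagram :: "(nat \<Rightarrow> nat) \<Rightarrow> (nat \<times> nat) set" where
  "diagram p = {(i, j). j < p i}"

text \<open>Tableaux take the dummy value 0 outside the diagram, so that each is counted once.\<close>

definition standard_tableaux :: "(nat \<Rightarrow> nat) \<Rightarrow> (nat \<times> nat \<Rightarrow> nat) set" where
  "standard_tableaux p = {T. bij_betw T (diagram p) {1..psize p} \<and>
     (\<forall>c. c \<notin> diagram p \<longrightarrow> T c = 0) \<and>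
     (\<forall>i j j'. j < j' \<and> (i, j') \<in> diagram p \<longrightarrow> T (i, j) < T (i, j')) \<and>
     (\<forall>i i' j. i < i' \<and> (i', j) \<in> diagram p \<longrightarrow> T (i, j) < T (i', j))}"

definition dim_partition :: "(nat \<Rightarrow> nat) \<Rightarrow> nat" where
  "dim_partition p = card (standard_tableaux p)"


section \<open>The deformed partition function\<close>

text \<open>
  With 0-based \<open>i\<close>, the numbers \<open>\<lambda>\<^sub>i - i + 1\<close> and \<open>- i + 1\<close> become \<open>p i - i\<close> and \<open>- i\<close>;
  the summands with \<open>p i = 0\<close> vanish.
\<close>

definition phi4D :: "nat \<Rightarrow> (nat \<Rightarrow> nat) \<Rightarrow> int" where
  "phi4D k p = (\<Sum>i | p i \<noteq> 0. (int (p i) - int i) ^ k - (- int i) ^ k)"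

text \<open>
  The parameter \<open>\<Lambda>\<close> is formal: \<open>fps_X\<close> stands for \<open>\<Lambda>\<^sup>2\<close>. The infinite sum is taken
  coefficientwise in \<open>T\<close> with respect to the \<open>\<Lambda>\<^sup>2\<close>-adic topology of \<open>'a fps\<close>.
\<close>

definition Z4D_term :: "'a::field_char_0 \<Rightarrow> (nat \<Rightarrow> nat) \<Rightarrow> 'a fps series" where
  "Z4D_term hbar p \<alpha> =
     fps_const ((of_nat (dim_partition p) / fact (psize p))\<^sup>2)
     * (fps_X * fps_const (1 / hbar\<^sup>2)) ^ psize p
     * fps_const (exp_linear (\<lambda>i. of_int (phi4D (Suc i) p)) \<alpha>)"

definition Z4D :: "'a::field_char_0 \<Rightarrow> 'a fps series" where
  "Z4D hbar \<alpha> = infsum (\<lambda>p. Z4D_term hbar p \<alpha>) partitions"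


section \<open>Finiteness and convergence of the sums\<close>

lemma finite_splits: "finite (splits \<gamma>)"
proof -
  let ?K = "Poly_Mapping.keys \<gamma>" and ?M = "Max (range (Poly_Mapping.lookup \<gamma>))"
  have fin: "finite (range (Poly_Mapping.lookup \<gamma>))"
  proof (rule finite_subset)
    show "range (Poly_Mapping.lookup \<gamma>) \<subseteq> insert 0 (Poly_Mapping.lookup \<gamma> ` ?K)"
      by (auto simp: in_keys_iff)
  qed simp
  have *: "Poly_Mapping.lookup \<alpha> \<in> {f. (\<forall>i. f i \<le> Poly_Mapping.lookup \<gamma> i)}" "\<beta> = \<gamma> - \<alpha>"
    if "(\<alpha>, \<beta>) \<in> splits \<gamma>" for \<alpha> \<beta>
    using that by (auto simp: splits_def lookup_add)
  have "{f. (\<forall>i. f i \<le> Poly_Mapping.lookup \<gamma> i)} \<subseteq> {f. \<forall>i. (i \<in> ?K \<longrightarrow> f i \<in> {..?M}) \<and> (i \<notin> ?K \<longrightarrow> f i = 0)}"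
  proof safe
    fix f i assume f: "\<forall>i. f i \<le> Poly_Mapping.lookup \<gamma> i"
    have "Poly_Mapping.lookup \<gamma> i \<le> ?M" using fin by (intro Max_ge) auto
    with f show "f i \<le> ?M" by (meson order_trans)
    assume "i \<notin> ?K"
    with f show "f i = 0" by (metis in_keys_iff le_zero_eq)
  qed
  hence "finite {f. (\<forall>i. f i \<le> Poly_Mapping.lookup \<gamma> i)}"
    by (rule finite_subset) (intro finite_set_of_finite_funs; simp)
  hence "finite (Poly_Mapping.lookup -` {f. (\<forall>i. f i \<le> Poly_Mapping.lookup \<gamma> i)})"
    by (rule finite_vimageI) (auto intro: injI simp: lookup_inject)
  hence "finite ((\<lambda>\<alpha>. (\<alpha>, \<gamma> - \<alpha>)) ` (Poly_Mapping.lookup -` {f. (\<forall>i. f i \<le> Poly_Mapping.lookup \<gamma> i)}))"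
    by (rule finite_imageI)
  thus ?thesis
    by (rule finite_subset[rotated]) (use * in auto)
qed

lemma finite_weight: "finite {\<beta>. weight \<beta> = m}"
proof -
  have le: "Poly_Mapping.lookup \<beta> i \<le> m \<and> (i > m \<longrightarrow> Poly_Mapping.lookup \<beta> i = 0)" if "weight \<beta> = m" for \<beta> i
  proof (cases "i \<in> Poly_Mapping.keys \<beta>")
    case True
    have "Suc i * Poly_Mapping.lookup \<beta> i \<le> weight \<beta>"
      unfolding weight_def by (rule member_le_sum[OF True]) auto
    moreover have "Poly_Mapping.lookup \<beta> i \<ge> 1" using True by (simp add: in_keys_iff)
    ultimately have "Poly_Mapping.lookup \<beta> i \<le> m" "Suc i \<le> m"
      using that mult_le_mono[of 1 "Suc i" "Poly_Mapping.lookup \<beta> i" "Poly_Mapping.lookup \<beta> i"]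
            mult_le_mono[of "Suc i" "Suc i" 1 "Poly_Mapping.lookup \<beta> i"] by auto
    thus ?thesis by auto
  next
    case False
    thus ?thesis by (simp add: in_keys_iff)
  qed
  have "finite (Poly_Mapping.lookup -` {f. \<forall>i. (i \<in> {..m} \<longrightarrow> f i \<in> {..m}) \<and> (i \<notin> {..m} \<longrightarrow> f i = (0::nat))} :: multiindex set)"
    by (rule finite_vimageI, rule finite_set_of_finite_funs) (auto intro: injI simp: lookup_inject)
  thus ?thesis
    by (rule finite_subset[rotated]) (use le in auto)
qed

lemma finite_partitions_of: "finite {p \<in> partitions. psize p = n}"
proof -
  have le: "p i \<le> n \<and> (i > n \<longrightarrow> p i = 0)" if p: "p \<in> partitions" "psize p = n" for p i
  proof
    have fin: "finite {i. p i \<noteq> 0}" and anti: "antimono p"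
      using p by (auto simp: partitions_def)
    show "p i \<le> n"
    proof (cases "p i = 0")
      case False
      thus ?thesis using p member_le_sum[of i "{i. p i \<noteq> 0}" p] fin by (auto simp: psize_def)
    qed simp
    show "i > n \<longrightarrow> p i = 0"
    proof (intro impI, rule ccontr)
      assume i: "n < i" "p i \<noteq> 0"
      have sub: "{..i} \<subseteq> {i. p i \<noteq> 0}"
      proof
        fix j assume "j \<in> {..i}"
        hence "p i \<le> p j" using anti by (auto simp: antimono_def)
        thus "j \<in> {i. p i \<noteq> 0}" using i by auto
      qed
      have "Suc i \<le> card {i. p i \<noteq> 0}" using card_mono[OF fin sub] by simp
      also have "\<dots> = (\<Sum>i | p i \<noteq> 0. 1)" by simp
      also have "\<dots> \<le> psize p" unfolding psize_def by (rule sum_mono) auto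
      finally show False using i p by simp
    qed
  qed
  have "finite {f. \<forall>i. (i \<in> {..n} \<longrightarrow> f i \<in> {..n}) \<and> (i \<notin> {..n} \<longrightarrow> f i = (0::nat))}"
    by (rule finite_set_of_finite_funs) auto
  thus ?thesis
    by (rule finite_subset[rotated]) (use le in auto)
qed

lemma Z4D_term_nth_0: "n \<noteq> psize p \<Longrightarrow> fps_nth (Z4D_term hbar p \<alpha>) n = 0"
  by (simp add: Z4D_term_def power_mult_distrib fps_const_power mult.assoc
                fps_X_power_mult_nth flip: fps_const_mult)

lemma has_sum_Z4D:
  "((\<lambda>p. Z4D_term hbar p \<alpha>) has_sum
      Abs_fps (\<lambda>n. \<Sum>p | p \<in> partitions \<and> psize p = n. fps_nth (Z4D_term hbar p \<alpha>) n)) partitions"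
  (is "(_ has_sum ?Z) _")
  unfolding has_sum_def
proof (rule tendsto_fpsI)
  fix n
  let ?P = "{p \<in> partitions. psize p = n}"
  show "\<forall>\<^sub>F F in finite_subsets_at_top partitions.
          fps_nth (\<Sum>p\<in>F. Z4D_term hbar p \<alpha>) n = fps_nth ?Z n"
    unfolding eventually_finite_subsets_at_top
  proof (intro exI[of _ ?P] conjI allI impI)
    fix F assume F: "finite F \<and> ?P \<subseteq> F \<and> F \<subseteq> partitions"
    have "(\<Sum>p\<in>?P. fps_nth (Z4D_term hbar p \<alpha>) n) = (\<Sum>p\<in>F. fps_nth (Z4D_term hbar p \<alpha>) n)"
      using F by (intro sum.mono_neutral_left) (auto intro!: Z4D_term_nth_0)
    thus "fps_nth (\<Sum>p\<in>F. Z4D_term hbar p \<alpha>) n = fps_nth ?Z n"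
      by (simp add: fps_sum_nth)
  qed (use finite_partitions_of in auto)
qed

lemma Z4D_nth:
  "fps_nth (Z4D hbar \<alpha>) n = (\<Sum>p | p \<in> partitions \<and> psize p = n. fps_nth (Z4D_term hbar p \<alpha>) n)"
  using infsumI[OF has_sum_Z4D, of hbar \<alpha>] by (simp add: Z4D_def)

end

theory Submission
  imports Defs
begin

text \<open>
  For partitions with at most \<open>N\<close> rows, \<open>l\<^sub>i = \<lambda>\<^sub>i + N - i\<close> runs over the \<open>N\<close>-element sets of natural
  numbers. By the Frobenius formula \<open>dim \<lambda> / |\<lambda>|! = \<Prod>\<^bsub>i<j\<^esub> (l\<^sub>i - l\<^sub>j) / \<Prod> l\<^sub>i!\<close>, and up to the factor
  \<open>exp (linear)\<close>, which drops out of the bilinear identity, the sum is a discrete matrix model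
  \<open>\<Sum>\<^sub>S \<Prod>\<^bsub>u\<noteq>v\<in>S\<^esub> (u - v) \<Prod>\<^bsub>u\<in>S\<^esub> w(u) exp (\<Sum>k. T\<^sub>k (u - N + 1)^k)\<close>. On a pair of exponentials with point sets
  \<open>x\<close> and \<open>y\<close> the integrand of the bilinear identity is a polynomial in \<open>z\<close> times
  \<open>\<Prod>\<^bsub>u\<in>x\<^esub> (z - u) / \<Prod>\<^bsub>u\<in>y\<^esub> (z - u)\<close>, whose residues sit at the points of \<open>y\<close>. Moving the
  pole from \<open>y\<close> to \<open>x\<close> and collecting terms, the sum vanishes by Lagrange interpolation. A fixed
  power of \<open>\<Lambda>\<^sup>2\<close> only involves finitely many pairs, so \<open>N\<close> can be chosen in terms of that power.
\<close>

section \<open>Partial fractions\<close>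

text \<open>The exchange works because the weights contain squared Vandermonde products. Adding
  \<open>v\<close> to \<open>x\<close> multiplies the weight by the square of its differences to
  \<open>x\<close>, removing \<open>v\<close> from \<open>y\<close> divides by the square of its
  differences to \<open>y - {v}\<close>. This inverts the residue quotient, so the differences to
  \<open>x\<close> end up in the denominator: the Lagrange quotient of the enlarged set. At the
  pole, exp of the sum of (t'_k - t_k) z^k adds \<open>v\<close> to the power sums of
  \<open>x\<close> and takes it from those of \<open>y\<close>, so this factor too depends only on
  the new pair. The power of \<Lambda>^2 is, up to a constant, the sum of all points, which the
  exchange preserves.

  Two obstacles shape the rest. The points representing a partition depend on N, so no single set of
  points serves all of Z; the identity is therefore polarised to a bilinear form and tested
  separately on each power of \<Lambda>^2. And \<open>dim_partition\<close> counts tableaux, so the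
  Frobenius formula has to be derived: both of its sides obey the branching rule, the product side
  by partial fractions of the product of 1 - 1 / (z - a_j).\<close>

lemma split_fraction:
  fixes z a b :: "'a::field"
  assumes "a \<noteq> b" "z \<noteq> a" "z \<noteq> b"
  shows "1 / ((z - a) * (z - b)) = 1 / ((a - b) * (z - a)) + 1 / ((b - a) * (z - b))"
  using assms by (simp add: divide_simps) (simp add: algebra_simps)

text \<open>When a point \<open>b\<close> is added, its coefficient is itself an instance of the
  induction hypothesis, at \<open>z = a b\<close>. Each old term then pairs with one pole at
  \<open>a b\<close>, and \<open>split_fraction\<close> merges the pair.\<close>

lemma sum_partial_fraction:
  fixes a :: "'i \<Rightarrow> 'a::field"
  assumes "finite I" "I \<noteq> {}" "inj_on a I" "z \<notin> a ` I"
  shows "(\<Sum>i\<in>I. 1 / ((\<Prod>j\<in>I-{i}. a i - a j) * (z - a i))) = 1 / (\<Prod>j\<in>I. z - a j)"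
  using assms
proof (induction I arbitrary: z rule: finite_ne_induct)
  case (insert b I)
  let ?c = "\<lambda>i. 1 / (\<Prod>j\<in>I-{i}. a i - a j)"
  have inj: "inj_on a I" and b: "a b \<notin> a ` I" and zb: "z \<noteq> a b" and z: "z \<notin> a ` I"
    using insert.prems insert.hyps by auto
  have pb: "(\<Prod>j\<in>insert b I-{i}. a i - a j) = (a i - a b) * (\<Prod>j\<in>I-{i}. a i - a j)" if "i \<in> I" for i
  proof -
    have "insert b I - {i} = insert b (I - {i})" using that insert.hyps by auto
    then show ?thesis using insert.hyps by simp
  qed
  have "(\<Sum>i\<in>insert b I. 1 / ((\<Prod>j\<in>insert b I-{i}. a i - a j) * (z - a i)))
     = 1 / ((\<Prod>j\<in>I. a b - a j) * (z - a b)) + (\<Sum>i\<in>I. ?c i * (1 / ((a i - a b) * (z - a i))))"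
    using insert.hyps by (simp add: pb Diff_insert_absorb mult_ac cong: sum.cong)
  also have "1 / ((\<Prod>j\<in>I. a b - a j) * (z - a b)) = (\<Sum>i\<in>I. ?c i * (1 / ((a b - a i) * (z - a b))))"
    unfolding divide_divide_eq_left[symmetric] insert.IH[OF inj b, symmetric] sum_divide_distrib
    by (simp add: mult.assoc)
  also have "\<dots> + (\<Sum>i\<in>I. ?c i * (1 / ((a i - a b) * (z - a i))))
     = (\<Sum>i\<in>I. ?c i * (1 / ((z - a i) * (z - a b))))"
    unfolding sum.distrib[symmetric]
  proof (rule sum.cong[OF refl])
    fix i assume "i \<in> I"
    then have "a i \<noteq> a b" "z \<noteq> a i" using b z by (metis imageI)+
    then show "?c i * (1 / ((a b - a i) * (z - a b))) + ?c i * (1 / ((a i - a b) * (z - a i)))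
      = ?c i * (1 / ((z - a i) * (z - a b)))"
      using split_fraction[of "a i" "a b" z] zb by (simp only: ring_distribs(1)[symmetric] add.commute not_False_eq_True simp_thms)
  qed
  also have "\<dots> = (\<Sum>i\<in>I. 1 / ((\<Prod>j\<in>I-{i}. a i - a j) * (z - a i))) / (z - a b)"
    by (simp add: sum_divide_distrib mult.assoc)
  also have "\<dots> = 1 / (\<Prod>j\<in>insert b I. z - a j)"
    using insert.IH[OF inj z] insert.hyps by simp
  finally show ?case .
qed auto

text \<open>With X standing for 1/z, this is z / (z - v) expanded at infinity.\<close>

definition geometric_fps :: "'a::field \<Rightarrow> 'a fps" where
  "geometric_fps v = Abs_fps (\<lambda>n. v ^ n)"

lemma geometric_fps_nth [simp]: "fps_nth (geometric_fps v) n = v ^ n"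
  by (simp add: geometric_fps_def)

lemma geometric_fps_mult [simp]: "(1 - fps_const v * fps_X) * geometric_fps v = 1"
proof (rule fps_ext)
  fix n show "fps_nth ((1 - fps_const v * fps_X) * geometric_fps v) n = fps_nth 1 n"
    by (cases n) (simp_all add: left_diff_distrib mult.assoc)
qed

text \<open>Two-pole partial fractions at infinity: since (1 - a X) A = 1 = (1 - b X) B, one gets (b
  - a) X A B = B - A.\<close>

lemma geometric_fps_product:
  assumes "a \<noteq> b"
  shows "fps_X * geometric_fps a * geometric_fps b
    = fps_const (1 / (b - a)) * geometric_fps b + fps_const (1 / (a - b)) * geometric_fps a"
proof -
  let ?A = "geometric_fps a" and ?B = "geometric_fps b"
  have "fps_const (b - a) * (fps_X * ?A * ?B)
      = ?B * ((1 - fps_const a * fps_X) * ?A) - ?A * ((1 - fps_const b * fps_X) * ?B)"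
    by (simp add: algebra_simps del: geometric_fps_mult flip: fps_const_sub)
  then have "fps_const (b - a) * (fps_X * ?A * ?B) = ?B - ?A" by simp
  then have "fps_const (1 / (b - a)) * (fps_const (b - a) * (fps_X * ?A * ?B))
      = fps_const (1 / (b - a)) * (?B - ?A)" by simp
  also have "fps_const (1 / (b - a)) * (fps_const (b - a) * (fps_X * ?A * ?B)) = fps_X * ?A * ?B"
    using assms by (simp add: mult.assoc[symmetric] fps_const_mult del: fps_const_divide)
  also have "fps_const (1 / (b - a)) * (?B - ?A) = fps_const (1 / (b - a)) * ?B + fps_const (1 / (a - b)) * ?A"
  proof -
    have "1 / (a - b) = - (1 / (b - a))" by (metis minus_diff_eq minus_divide_right)
    then show ?thesis by (simp add: algebra_simps flip: fps_const_neg)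
  qed
  finally show ?thesis .
qed

lemma fps_sum_const: "(\<Sum>i\<in>I. fps_const (f i)) = fps_const (\<Sum>i\<in>I. f i)"
  by (induction I rule: infinite_finite_induct) simp_all

text \<open>This is \<open>sum_partial_fraction\<close> expanded at infinity. There 1 / (z - a) is X
  times a geometric series; one factor X has been cancelled on both sides, whence the exponent
  \<open>card I - 1\<close>.\<close>

lemma fps_partial_fraction:
  fixes a :: "'i \<Rightarrow> 'a::field"
  assumes "finite I" "I \<noteq> {}" "inj_on a I"
  shows "fps_X ^ (card I - 1) * (\<Prod>i\<in>I. geometric_fps (a i))
    = (\<Sum>i\<in>I. fps_const (1 / (\<Prod>j\<in>I-{i}. a i - a j)) * geometric_fps (a i))"
  using assms
proof (induction I rule: finite_ne_induct)
  case (insert b I)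
  let ?c = "\<lambda>i. 1 / (\<Prod>j\<in>I-{i}. a i - a j)"
  have inj: "inj_on a I" and b: "a b \<notin> a ` I"
    using insert.prems insert.hyps by auto
  have pb: "(\<Prod>j\<in>insert b I-{i}. a i - a j) = (a i - a b) * (\<Prod>j\<in>I-{i}. a i - a j)" if "i \<in> I" for i
  proof -
    have "insert b I - {i} = insert b (I - {i})" using that insert.hyps by auto
    then show ?thesis using insert.hyps by simp
  qed
  have card: "card (insert b I) - 1 = Suc (card I - 1)"
    using insert.hyps card_gt_0_iff[of I] by simp
  have "fps_X ^ (card (insert b I) - 1) * (\<Prod>i\<in>insert b I. geometric_fps (a i))
    = fps_X * geometric_fps (a b) * (fps_X ^ (card I - 1) * (\<Prod>i\<in>I. geometric_fps (a i)))"
    unfolding card using insert.hyps by (simp add: mult_ac)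
  also have "\<dots> = (\<Sum>i\<in>I. fps_const (?c i) * (fps_X * geometric_fps (a b) * geometric_fps (a i)))"
    unfolding insert.IH[OF inj] by (simp add: sum_distrib_left mult_ac)
  also have "\<dots> = (\<Sum>i\<in>I. fps_const (?c i * (1 / (a i - a b))) * geometric_fps (a i)
      + fps_const (?c i * (1 / (a b - a i))) * geometric_fps (a b))"
  proof (rule sum.cong[OF refl])
    fix i assume "i \<in> I"
    then have "a b \<noteq> a i" using b by auto
    then show "fps_const (?c i) * (fps_X * geometric_fps (a b) * geometric_fps (a i))
      = fps_const (?c i * (1 / (a i - a b))) * geometric_fps (a i)
      + fps_const (?c i * (1 / (a b - a i))) * geometric_fps (a b)"
      unfolding geometric_fps_product[OF \<open>a b \<noteq> a i\<close>]
      by (simp only: ring_distribs mult.assoc[symmetric] fps_const_mult)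
  qed
  also have "\<dots> = (\<Sum>i\<in>I. fps_const (?c i * (1 / (a i - a b))) * geometric_fps (a i))
      + fps_const (\<Sum>i\<in>I. ?c i * (1 / (a b - a i))) * geometric_fps (a b)"
    unfolding sum.distrib sum_distrib_right[symmetric] by (simp only: fps_sum_const)
  \<comment> \<open>The contributions to the pole at \<open>a b\<close> collect into one constant,
    which the scalar identity evaluates at \<open>z = a b\<close>.\<close>
  also have "(\<Sum>i\<in>I. ?c i * (1 / (a b - a i))) = 1 / (\<Prod>j\<in>I. a b - a j)"
    using sum_partial_fraction[OF insert.hyps(1,2) inj b] by simp
  also have "(\<Sum>i\<in>I. fps_const (?c i * (1 / (a i - a b))) * geometric_fps (a i))
      + fps_const (1 / (\<Prod>j\<in>I. a b - a j)) * geometric_fps (a b)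
    = (\<Sum>i\<in>insert b I. fps_const (1 / (\<Prod>j\<in>insert b I-{i}. a i - a j)) * geometric_fps (a i))"
    using insert.hyps by (simp add: pb Diff_insert_absorb mult.commute add.commute
       del: fps_const_divide cong: sum.cong)
  finally show ?case .
qed simp

text \<open>The sum is the coefficient of X^k in \<open>fps_partial_fraction\<close>, whose left
  side starts only at X^(card I - 1).\<close>

lemma lagrange_power_sum:
  fixes a :: "'i \<Rightarrow> 'a::field"
  assumes "finite I" "inj_on a I" "Suc k < card I"
  shows "(\<Sum>i\<in>I. a i ^ k / (\<Prod>j\<in>I-{i}. a i - a j)) = 0"
proof -
  have ne: "I \<noteq> {}" using assms by auto
  have "(\<Sum>i\<in>I. a i ^ k / (\<Prod>j\<in>I-{i}. a i - a j))
    = fps_nth (\<Sum>i\<in>I. fps_const (1 / (\<Prod>j\<in>I-{i}. a i - a j)) * geometric_fps (a i)) k"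
    by (simp add: fps_sum_nth del: fps_const_divide)
  also have "\<dots> = fps_nth (fps_X ^ (card I - 1) * (\<Prod>i\<in>I. geometric_fps (a i))) k"
    by (simp only: fps_partial_fraction[OF assms(1) ne assms(2)])
  also have "\<dots> = 0" using assms(3) by (simp add: fps_X_power_mult_nth)
  finally show ?thesis .
qed

lemma lagrange_poly_sum:
  fixes a :: "'i \<Rightarrow> 'a::field"
  assumes "finite I" "inj_on a I" "Suc (degree p) < card I"
  shows "(\<Sum>i\<in>I. poly p (a i) / (\<Prod>j\<in>I-{i}. a i - a j)) = 0"
proof -
  have "(\<Sum>i\<in>I. poly p (a i) / (\<Prod>j\<in>I-{i}. a i - a j))
    = (\<Sum>i\<in>I. \<Sum>k\<le>degree p. coeff p k * (a i ^ k / (\<Prod>j\<in>I-{i}. a i - a j)))"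
    by (simp add: poly_altdef sum_divide_distrib)
  also have "\<dots> = (\<Sum>k\<le>degree p. coeff p k * (\<Sum>i\<in>I. a i ^ k / (\<Prod>j\<in>I-{i}. a i - a j)))"
    by (subst sum.swap) (simp add: sum_distrib_left)
  also have "\<dots> = 0"
    by (intro sum.neutral ballI) (use assms in \<open>simp add: lagrange_power_sum\<close>)
  finally show ?thesis .
qed

text \<open>A partial fraction expansion with value 1 at infinity and simple poles. The products at
  the poles are the factors by which a Vandermonde product changes when one variable is lowered by
  1, see \<open>vandermonde_shift\<close>.\<close>

lemma shifted_ratio_partial_fraction:
  fixes a :: "'i \<Rightarrow> 'a::field"
  assumes "finite I" "inj_on a I" "z \<notin> a ` I"
  shows "(\<Prod>j\<in>I. 1 - 1 / (z - a j))
    = 1 - (\<Sum>i\<in>I. (\<Prod>j\<in>I-{i}. 1 - 1 / (a i - a j)) * (1 / (z - a i)))"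
  using assms
proof (induction I arbitrary: z rule: finite_induct)
  case (insert b I)
  let ?A = "\<lambda>i. \<Prod>j\<in>I-{i}. 1 - 1 / (a i - a j)"
  have inj: "inj_on a I" and b: "a b \<notin> a ` I" and zb: "z \<noteq> a b" and z: "z \<notin> a ` I"
    using insert.prems insert.hyps by auto
  have pb: "(\<Prod>j\<in>insert b I-{i}. 1 - 1 / (a i - a j)) = (1 - 1 / (a i - a b)) * ?A i" if "i \<in> I" for i
  proof -
    have "insert b I - {i} = insert b (I - {i})" using that insert.hyps by auto
    then show ?thesis using insert.hyps by simp
  qed
  have "(\<Sum>i\<in>insert b I. (\<Prod>j\<in>insert b I-{i}. 1 - 1 / (a i - a j)) * (1 / (z - a i)))
     = (\<Prod>j\<in>I. 1 - 1 / (a b - a j)) * (1 / (z - a b)) + (\<Sum>i\<in>I. (1 - 1 / (a i - a b)) * ?A i * (1 / (z - a i)))"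
    using insert.hyps by (simp add: pb Diff_insert_absorb cong: sum.cong)
  also have "\<dots> = 1 / (z - a b) + (\<Sum>i\<in>I. (1 - 1 / (a i - a b)) * ?A i * (1 / (z - a i)) - ?A i * (1 / (a b - a i)) * (1 / (z - a b)))"
    unfolding insert.IH[OF inj b]
    by (simp only: sum_subtractf sum_distrib_right[symmetric] left_diff_distrib mult_1_left) (simp add: algebra_simps)
  also have "\<dots> = 1 / (z - a b) + (\<Sum>i\<in>I. ?A i * (1 / (z - a i)) * (1 - 1 / (z - a b)))"
  proof (intro arg_cong2[of _ _ _ _ "(+)"] sum.cong refl)
    fix i assume "i \<in> I"
    then have ab: "a i \<noteq> a b" "z \<noteq> a i" using b z by (metis imageI)+
    have "(1 - 1 / (a i - a b)) * ?A i * (1 / (z - a i)) - ?A i * (1 / (a b - a i)) * (1 / (z - a b))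
      = ?A i * (1 / (z - a i) - (1 / ((a i - a b) * (z - a i)) + 1 / ((a b - a i) * (z - a b))))"
      by (simp add: algebra_simps)
    also have "\<dots> = ?A i * (1 / (z - a i)) * (1 - 1 / (z - a b))"
    proof -
      have *: "1 / ((z - a i) * (z - a b)) = 1 / (z - a i) * (1 / (z - a b))" by simp
      show ?thesis unfolding split_fraction[OF ab zb, symmetric] unfolding * by (simp add: right_diff_distrib mult.assoc)
    qed
    finally show "(1 - 1 / (a i - a b)) * ?A i * (1 / (z - a i)) - ?A i * (1 / (a b - a i)) * (1 / (z - a b))
      = ?A i * (1 / (z - a i)) * (1 - 1 / (z - a b))" .
  qed
  also have "\<dots> = 1 / (z - a b) + (1 - (\<Prod>j\<in>I. 1 - 1 / (z - a j))) * (1 - 1 / (z - a b))"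
    unfolding insert.IH[OF inj z] by (simp add: sum_distrib_right)
  also have "\<dots> = 1 - (\<Prod>j\<in>insert b I. 1 - 1 / (z - a j))"
    using insert.hyps by (simp add: algebra_simps)
  finally show ?case by simp
qed simp

text \<open>Conceptually, these compare the coefficients of 1/z and 1/z^2 at infinity in the
  preceding expansion. The induction obtains them from that expansion evaluated at the new point
  \<open>a b\<close>. The second sum later produces the size of a partition.\<close>

lemma sum_shifted_ratio:
  fixes a :: "'i \<Rightarrow> 'a::field_char_0"
  assumes "finite I" "inj_on a I"
  shows "(\<Sum>i\<in>I. \<Prod>j\<in>I-{i}. 1 - 1 / (a i - a j)) = of_nat (card I)"
    and "(\<Sum>i\<in>I. a i * (\<Prod>j\<in>I-{i}. 1 - 1 / (a i - a j))) = (\<Sum>i\<in>I. a i) - of_nat (\<Sum>k<card I. k)"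
  using assms
proof (induction I rule: finite_induct)
  case (insert b I)
  let ?A = "\<lambda>i. \<Prod>j\<in>I-{i}. 1 - 1 / (a i - a j)"
  {
    case 1
    have inj: "inj_on a I" and b: "a b \<notin> a ` I"
      using 1 insert.hyps by auto
    have pb: "(\<Prod>j\<in>insert b I-{i}. 1 - 1 / (a i - a j)) = ?A i + ?A i * (1 / (a b - a i))" if "i \<in> I" for i
    proof -
      have "insert b I - {i} = insert b (I - {i})" using that insert.hyps by auto
      moreover have "1 / (a i - a b) = - (1 / (a b - a i))" by (metis minus_diff_eq minus_divide_right)
      ultimately show ?thesis using insert.hyps by (simp add: algebra_simps)
    qed
    show ?case
      using insert.hyps insert.IH(1)[OF inj] shifted_ratio_partial_fraction[OF insert.hyps(1) inj b]
      by (simp add: pb Diff_insert_absorb sum.distrib cong: sum.cong)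
  next
    case 2
    have inj: "inj_on a I" and b: "a b \<notin> a ` I"
      using 2 insert.hyps by auto
    have pb: "a i * (\<Prod>j\<in>insert b I-{i}. 1 - 1 / (a i - a j))
       = a i * ?A i - ?A i + a b * (?A i * (1 / (a b - a i)))" if "i \<in> I" for i
    proof -
      have ab: "a i \<noteq> a b" using that b by (metis imageI)
      have "insert b I - {i} = insert b (I - {i})" using that insert.hyps by auto
      then have "a i * (\<Prod>j\<in>insert b I-{i}. 1 - 1 / (a i - a j)) = ?A i * (a i * (1 - 1 / (a i - a b)))"
        using insert.hyps by simp
      also have "a i * (1 - 1 / (a i - a b)) = a i - 1 + a b * (1 / (a b - a i))"
        using ab by (simp add: divide_simps) (simp add: algebra_simps)
      finally show ?thesis by (simp add: algebra_simps)
    qed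
    have "(\<Sum>i\<in>insert b I. a i * (\<Prod>j\<in>insert b I-{i}. 1 - 1 / (a i - a j)))
      = a b * (\<Prod>j\<in>I. 1 - 1 / (a b - a j)) + (\<Sum>i\<in>I. a i * ?A i - ?A i + a b * (?A i * (1 / (a b - a i))))"
      using insert.hyps by (simp add: pb Diff_insert_absorb cong: sum.cong)
    also have "\<dots> = a b * ((\<Prod>j\<in>I. 1 - 1 / (a b - a j)) + (\<Sum>i\<in>I. ?A i * (1 / (a b - a i))))
       + (\<Sum>i\<in>I. a i * ?A i) - (\<Sum>i\<in>I. ?A i)"
      by (simp only: sum.distrib sum_subtractf sum_distrib_left[symmetric]) (simp add: algebra_simps)
    also have "\<dots> = a b + (\<Sum>i\<in>I. a i) - of_nat (\<Sum>k<card I. k) - of_nat (card I)"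
      unfolding shifted_ratio_partial_fraction[OF insert.hyps(1) inj b] insert.IH(1)[OF inj] insert.IH(2)[OF inj]
      by simp
    finally show ?case using insert.hyps by simp
  }
qed simp_all

section \<open>Exponentials of linear forms\<close>

abbreviation unit_index :: "nat \<Rightarrow> multiindex" where
  "unit_index i \<equiv> Poly_Mapping.single i (Suc 0)"

lemma exp_linear_superset:
  assumes "finite A" "Poly_Mapping.keys \<alpha> \<subseteq> A"
  shows "exp_linear c \<alpha> = (\<Prod>i\<in>A. c i ^ Poly_Mapping.lookup \<alpha> i / fact (Poly_Mapping.lookup \<alpha> i))"
  unfolding exp_linear_def using assms by (intro prod.mono_neutral_left) (auto simp: in_keys_iff)

lemma weight_superset:
  assumes "finite A" "Poly_Mapping.keys \<alpha> \<subseteq> A"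
  shows "weight \<alpha> = (\<Sum>i\<in>A. Suc i * Poly_Mapping.lookup \<alpha> i)"
  unfolding weight_def using assms by (intro sum.mono_neutral_left) (auto simp: in_keys_iff)

lemma weight_add: "weight (\<alpha> + \<beta>) = weight \<alpha> + weight \<beta>"
proof -
  let ?A = "Poly_Mapping.keys \<alpha> \<union> Poly_Mapping.keys \<beta>"
  have "Poly_Mapping.keys (\<alpha> + \<beta>) \<subseteq> ?A" by (rule Poly_Mapping.keys_add)
  then have "weight (\<alpha> + \<beta>) = (\<Sum>i\<in>?A. Suc i * Poly_Mapping.lookup (\<alpha> + \<beta>) i)"
    by (intro weight_superset) auto
  also have "\<dots> = (\<Sum>i\<in>?A. Suc i * Poly_Mapping.lookup \<alpha> i) + (\<Sum>i\<in>?A. Suc i * Poly_Mapping.lookup \<beta> i)"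
    by (simp only: lookup_add distrib_left sum.distrib)
  also have "\<dots> = weight \<alpha> + weight \<beta>"
    by (subst (1 2) weight_superset[where A = ?A]) auto
  finally show ?thesis .
qed

lemma weight_unit_index [simp]: "weight (unit_index i) = Suc i"
  by (subst weight_superset[of "{i}"]) auto

lemma weight_eq_0_iff [simp]: "weight \<alpha> = 0 \<longleftrightarrow> \<alpha> = 0"
  by (auto simp: weight_def in_keys_iff intro!: poly_mapping_eqI)

lemma exp_linear_0 [simp]: "exp_linear c 0 = 1"
  by (simp add: exp_linear_def)

lemma exp_linear_scale: "exp_linear (\<lambda>i. a i * b i) \<alpha> = exp_linear a \<alpha> * (\<Prod>i\<in>Poly_Mapping.keys \<alpha>. b i ^ Poly_Mapping.lookup \<alpha> i)"
  by (simp add: exp_linear_def power_mult_distrib flip: prod.distrib)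

text \<open>Coefficient form of the differential equation dE/dt_i = c_i E, which is used below to
  characterise exponentials.\<close>

lemma exp_linear_add_unit:
  "of_nat (Suc (Poly_Mapping.lookup \<gamma> i)) * exp_linear c (\<gamma> + unit_index i) = c i * exp_linear c \<gamma>"
proof -
  let ?A = "insert i (Poly_Mapping.keys \<gamma>)" and ?B = "Poly_Mapping.keys \<gamma> - {i}"
  let ?f = "\<lambda>\<gamma> j. c j ^ Poly_Mapping.lookup \<gamma> j / fact (Poly_Mapping.lookup \<gamma> j)"
  have "Poly_Mapping.keys (\<gamma> + unit_index i) \<subseteq> ?A"
    using Poly_Mapping.keys_add[of \<gamma> "unit_index i"] by auto
  then have "exp_linear c (\<gamma> + unit_index i) = prod (?f (\<gamma> + unit_index i)) ?A"
    by (intro exp_linear_superset) auto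
  also have "\<dots> = c i ^ Suc (Poly_Mapping.lookup \<gamma> i) / fact (Suc (Poly_Mapping.lookup \<gamma> i)) * prod (?f (\<gamma> + unit_index i)) ?B"
    by (subst prod.insert_remove) (auto simp: lookup_add)
  also have "prod (?f (\<gamma> + unit_index i)) ?B = prod (?f \<gamma>) ?B"
    by (intro prod.cong) (auto simp: lookup_add lookup_single when_def)
  finally have "of_nat (Suc (Poly_Mapping.lookup \<gamma> i)) * exp_linear c (\<gamma> + unit_index i)
     = c i * (?f \<gamma> i * prod (?f \<gamma>) ?B)"
    by (simp add: field_simps del: of_nat_Suc)
  also have "?f \<gamma> i * prod (?f \<gamma>) ?B = prod (?f \<gamma>) ?A"
    by (subst prod.insert_remove) auto
  also have "\<dots> = exp_linear c \<gamma>"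
    by (rule exp_linear_superset[symmetric]) auto
  finally show ?thesis .
qed

lemma unit_index_decompose:
  assumes "Poly_Mapping.lookup \<alpha> i \<noteq> 0"
  shows "\<alpha> = (\<alpha> - unit_index i) + unit_index i"
  using assms by (intro poly_mapping_eqI) (auto simp: lookup_add lookup_minus lookup_single when_def)

lemma exp_linear_remove_unit:
  assumes "Poly_Mapping.lookup \<alpha> i \<noteq> 0"
  shows "of_nat (Poly_Mapping.lookup \<alpha> i) * exp_linear c \<alpha> = c i * exp_linear c (\<alpha> - unit_index i)"
proof -
  have "Poly_Mapping.lookup \<alpha> i = Suc (Poly_Mapping.lookup (\<alpha> - unit_index i) i)"
    using assms by (simp add: lookup_minus)
  then show ?thesis
    using exp_linear_add_unit[of "\<alpha> - unit_index i" i c] unit_index_decompose[OF assms] by simp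
qed

text \<open>Uniqueness for the system dF/dt_i = c_i F with F(0) = 1: every nonzero index arises from
  one of smaller weight by adding a unit.\<close>

lemma exp_linear_unique:
  assumes zero: "F 0 = 1"
    and step: "\<And>\<gamma> i. of_nat (Suc (Poly_Mapping.lookup \<gamma> i)) * F (\<gamma> + unit_index i) = c i * F \<gamma>"
  shows "F \<gamma> = exp_linear c \<gamma>"
proof (induction "weight \<gamma>" arbitrary: \<gamma> rule: less_induct)
  case less
  show ?case
  proof (cases "\<gamma> = 0")
    case False
    then obtain i where i: "Poly_Mapping.lookup \<gamma> i \<noteq> 0"
      by (metis lookup_zero poly_mapping_eqI)
    define \<delta> where "\<delta> = \<gamma> - unit_index i"
    have \<gamma>: "\<gamma> = \<delta> + unit_index i"
      unfolding \<delta>_def by (rule unit_index_decompose[OF i])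
    then have "F \<delta> = exp_linear c \<delta>"
      by (intro less) (simp add: weight_add)
    then have "of_nat (Suc (Poly_Mapping.lookup \<delta> i)) * F \<gamma> = of_nat (Suc (Poly_Mapping.lookup \<delta> i)) * exp_linear c \<gamma>"
      unfolding \<gamma> step exp_linear_add_unit by simp
    then show ?thesis by (simp del: of_nat_Suc)
  qed (simp add: zero)
qed

text \<open>One half of the Leibniz rule: d/dt_i acting on the left factor of a product whose left
  factor is an exponential.\<close>

lemma sum_splits_left_unit:
  fixes B :: "'a::field_char_0 series"
  shows "(\<Sum>(\<alpha>, \<beta>)\<in>splits (\<gamma> + unit_index i). of_nat (Poly_Mapping.lookup \<alpha> i) * exp_linear a \<alpha> * B \<beta>)
    = a i * (\<Sum>(\<alpha>, \<beta>)\<in>splits \<gamma>. exp_linear a \<alpha> * B \<beta>)"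
proof -
  have "(\<Sum>(\<alpha>, \<beta>)\<in>splits (\<gamma> + unit_index i). of_nat (Poly_Mapping.lookup \<alpha> i) * exp_linear a \<alpha> * B \<beta>)
     = (\<Sum>(\<alpha>, \<beta>)\<in>{(\<alpha>, \<beta>) \<in> splits (\<gamma> + unit_index i). Poly_Mapping.lookup \<alpha> i \<noteq> 0}. a i * exp_linear a (\<alpha> - unit_index i) * B \<beta>)"
    by (intro sum.mono_neutral_cong_right) (auto simp: finite_splits exp_linear_remove_unit)
  also have "\<dots> = (\<Sum>(\<alpha>, \<beta>)\<in>splits \<gamma>. a i * (exp_linear a \<alpha> * B \<beta>))"
  proof (rule sum.reindex_bij_witness[where
      j = "\<lambda>(\<alpha>, \<beta>). (\<alpha> - unit_index i, \<beta>)" and i = "\<lambda>(\<alpha>, \<beta>). (\<alpha> + unit_index i, \<beta>)"])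
    have "(\<alpha> - unit_index i, \<beta>) \<in> splits \<gamma>"
      if "(\<alpha>, \<beta>) \<in> splits (\<gamma> + unit_index i)" "Poly_Mapping.lookup \<alpha> i \<noteq> 0" for \<alpha> \<beta>
    proof -
      have "\<alpha> - unit_index i + unit_index i + \<beta> = \<gamma> + unit_index i"
        using that unit_index_decompose[of \<alpha> i] by (simp add: splits_def)
      then have "(\<alpha> - unit_index i + \<beta>) + unit_index i = \<gamma> + unit_index i"
        by (simp only: add_ac)
      then show ?thesis by (simp add: splits_def)
    qed
    then show "(case x of (\<alpha>, \<beta>) \<Rightarrow> (\<alpha> - unit_index i, \<beta>)) \<in> splits \<gamma>"
      if "x \<in> {(\<alpha>, \<beta>) \<in> splits (\<gamma> + unit_index i). Poly_Mapping.lookup \<alpha> i \<noteq> 0}" for x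
      using that by auto
  qed (auto simp: splits_def unit_index_decompose[symmetric] unit_index_decompose[symmetric, unfolded add.commute[of _ "unit_index _"]]
        lookup_add add_ac mult_ac)
  also have "\<dots> = a i * (\<Sum>(\<alpha>, \<beta>)\<in>splits \<gamma>. exp_linear a \<alpha> * B \<beta>)"
    by (simp add: sum_distrib_left case_prod_unfold)
  finally show ?thesis .
qed

lemma sum_splits_swap: "(\<Sum>(\<alpha>, \<beta>)\<in>splits \<gamma>. f \<alpha> \<beta>) = (\<Sum>(\<alpha>, \<beta>)\<in>splits \<gamma>. f \<beta> \<alpha>)"
  by (rule sum.reindex_bij_witness[of _ prod.swap prod.swap]) (auto simp: splits_def add.commute)

text \<open>The law exp(a) exp(b) = exp(a + b): by the Leibniz rule the product solves the system
  that characterises the right side.\<close>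

lemma exp_linear_convolution:
  "(\<Sum>(\<alpha>, \<beta>)\<in>splits \<gamma>. exp_linear a \<alpha> * exp_linear b \<beta>) = exp_linear (\<lambda>i. a i + b i) \<gamma>"
proof (rule exp_linear_unique[where F = "\<lambda>\<gamma>. \<Sum>(\<alpha>, \<beta>)\<in>splits \<gamma>. exp_linear a \<alpha> * exp_linear b \<beta>"])
  have "splits 0 = {(0, 0)}"
    by (auto simp: splits_def poly_mapping_eq_iff lookup_add fun_eq_iff plus_poly_mapping.rep_eq)
  then show "(\<Sum>(\<alpha>, \<beta>)\<in>splits 0. exp_linear a \<alpha> * exp_linear b \<beta>) = 1" by simp
next
  fix \<gamma> i
  have "of_nat (Suc (Poly_Mapping.lookup \<gamma> i)) * (\<Sum>(\<alpha>, \<beta>)\<in>splits (\<gamma> + unit_index i). exp_linear a \<alpha> * exp_linear b \<beta>)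
    = (\<Sum>(\<alpha>, \<beta>)\<in>splits (\<gamma> + unit_index i). of_nat (Poly_Mapping.lookup \<alpha> i) * exp_linear a \<alpha> * exp_linear b \<beta>
        + of_nat (Poly_Mapping.lookup \<beta> i) * exp_linear b \<beta> * exp_linear a \<alpha>)"
    unfolding sum_distrib_left
  proof (rule sum.cong[OF refl], safe)
    fix \<alpha> \<beta> assume "(\<alpha>, \<beta>) \<in> splits (\<gamma> + unit_index i)"
    then have "Poly_Mapping.lookup (\<alpha> + \<beta>) i = Poly_Mapping.lookup (\<gamma> + unit_index i) i" by (simp add: splits_def)
    then have "Suc (Poly_Mapping.lookup \<gamma> i) = Poly_Mapping.lookup \<alpha> i + Poly_Mapping.lookup \<beta> i" by (simp add: lookup_add)
    then show "of_nat (Suc (Poly_Mapping.lookup \<gamma> i)) * (exp_linear a \<alpha> * exp_linear b \<beta>)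
       = of_nat (Poly_Mapping.lookup \<alpha> i) * exp_linear a \<alpha> * exp_linear b \<beta>
        + of_nat (Poly_Mapping.lookup \<beta> i) * exp_linear b \<beta> * exp_linear a \<alpha>"
      by (simp add: algebra_simps del: of_nat_Suc)
  qed
  also have "\<dots> = (\<Sum>(\<alpha>, \<beta>)\<in>splits (\<gamma> + unit_index i). of_nat (Poly_Mapping.lookup \<alpha> i) * exp_linear a \<alpha> * exp_linear b \<beta>)
     + (\<Sum>(\<alpha>, \<beta>)\<in>splits (\<gamma> + unit_index i). of_nat (Poly_Mapping.lookup \<alpha> i) * exp_linear b \<alpha> * exp_linear a \<beta>)"
    by (subst (3) sum_splits_swap) (simp add: sum.distrib case_prod_unfold)
  also have "\<dots> = a i * (\<Sum>(\<alpha>, \<beta>)\<in>splits \<gamma>. exp_linear a \<alpha> * exp_linear b \<beta>)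
      + b i * (\<Sum>(\<alpha>, \<beta>)\<in>splits \<gamma>. exp_linear b \<alpha> * exp_linear a \<beta>)"
    unfolding sum_splits_left_unit ..
  also have "(\<Sum>(\<alpha>, \<beta>)\<in>splits \<gamma>. exp_linear b \<alpha> * exp_linear a \<beta>) = (\<Sum>(\<alpha>, \<beta>)\<in>splits \<gamma>. exp_linear a \<alpha> * exp_linear b \<beta>)"
    by (subst sum_splits_swap) (simp add: mult.commute)
  finally show "of_nat (Suc (Poly_Mapping.lookup \<gamma> i)) * (\<Sum>(\<alpha>, \<beta>)\<in>splits (\<gamma> + unit_index i). exp_linear a \<alpha> * exp_linear b \<beta>)
    = (a i + b i) * (\<Sum>(\<alpha>, \<beta>)\<in>splits \<gamma>. exp_linear a \<alpha> * exp_linear b \<beta>)"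
    by (simp add: algebra_simps)
qed

section \<open>The Miwa shift of an exponential\<close>

text \<open>The series \<open>exp (\<Sum>i. c i / (i + 1) * X ^ (i + 1))\<close>.\<close>

definition miwa_exp :: "(nat \<Rightarrow> 'a::field_char_0) \<Rightarrow> 'a fps" where
  "miwa_exp c = Abs_fps (\<lambda>m. \<Sum>\<beta> | weight \<beta> = m. exp_linear (\<lambda>i. c i / of_nat (Suc i)) \<beta>)"

lemma miwa_exp_nth_0 [simp]: "fps_nth (miwa_exp c) 0 = 1"
  by (simp add: miwa_exp_def)

text \<open>Differentiation multiplies by the weight m + 1, which is distributed over the indices as
  the sum of (i + 1) \<beta>_i. Taking one unit of index i off \<beta> leaves weight m - i and turns
  (i + 1) \<beta>_i times the coefficient into \<open>c i\<close> times the reduced one.\<close>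

lemma fps_deriv_miwa_exp: "fps_deriv (miwa_exp c) = Abs_fps c * miwa_exp c"
proof (rule fps_ext)
  fix m
  let ?e = "exp_linear (\<lambda>i. c i / of_nat (Suc i))"
  have "fps_nth (fps_deriv (miwa_exp c)) m = of_nat (Suc m) * (\<Sum>\<beta> | weight \<beta> = Suc m. ?e \<beta>)"
    by (simp add: miwa_exp_def)
  also have "\<dots> = (\<Sum>\<beta> | weight \<beta> = Suc m. \<Sum>i\<in>Poly_Mapping.keys \<beta>. of_nat (Suc i * Poly_Mapping.lookup \<beta> i) * ?e \<beta>)"
    unfolding sum_distrib_left
  proof (rule sum.cong[OF refl], safe)
    fix \<beta> assume "weight \<beta> = Suc m"
    then have "of_nat (Suc m) = (\<Sum>i\<in>Poly_Mapping.keys \<beta>. of_nat (Suc i * Poly_Mapping.lookup \<beta> i) :: 'a)"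
      by (simp only: weight_def of_nat_sum[symmetric])
    then show "of_nat (Suc m) * ?e \<beta> = (\<Sum>i\<in>Poly_Mapping.keys \<beta>. of_nat (Suc i * Poly_Mapping.lookup \<beta> i) * ?e \<beta>)"
      by (simp only: sum_distrib_right)
  qed
  also have "\<dots> = (\<Sum>(\<beta>, i)\<in>(SIGMA \<beta>:{\<beta>. weight \<beta> = Suc m}. Poly_Mapping.keys \<beta>). of_nat (Suc i * Poly_Mapping.lookup \<beta> i) * ?e \<beta>)"
    by (rule sum.Sigma) (auto simp: finite_weight)
  also have "\<dots> = (\<Sum>(i, \<gamma>)\<in>(SIGMA i:{0..m}. {\<gamma>. weight \<gamma> = m - i}). c i * ?e \<gamma>)"
  proof (rule sum.reindex_bij_witness[where
      j = "\<lambda>(\<beta>, i). (i, \<beta> - unit_index i)" and i = "\<lambda>(i, \<gamma>). (\<gamma> + unit_index i, i)"], safe)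
    fix \<beta> i assume w: "weight \<beta> = Suc m" and "i \<in> Poly_Mapping.keys \<beta>"
    then have i: "Poly_Mapping.lookup \<beta> i \<noteq> 0" by (simp add: in_keys_iff)
    show "(\<beta> - unit_index i) + unit_index i = \<beta>"
      using unit_index_decompose[OF i] by simp
    then have "weight (\<beta> - unit_index i) + Suc i = Suc m"
      using w weight_add[of "\<beta> - unit_index i" "unit_index i"] by simp
    then show "i \<in> {0..m}" "weight (\<beta> - unit_index i) = m - i" by auto
    show "c i * ?e (\<beta> - unit_index i) = of_nat (Suc i * Poly_Mapping.lookup \<beta> i) * ?e \<beta>"
      unfolding of_nat_mult mult.assoc exp_linear_remove_unit[OF i] by (simp del: of_nat_Suc)
  qed (auto simp: in_keys_iff lookup_add weight_add)
  also have "\<dots> = (\<Sum>i=0..m. c i * (\<Sum>\<gamma> | weight \<gamma> = m - i. ?e \<gamma>))"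
    unfolding sum_distrib_left by (rule sum.Sigma[symmetric]) (auto simp: finite_weight)
  also have "\<dots> = fps_nth (Abs_fps c * miwa_exp c) m"
    by (simp add: fps_mult_nth miwa_exp_def)
  finally show "fps_nth (fps_deriv (miwa_exp c)) m = fps_nth (Abs_fps c * miwa_exp c) m" .
qed

lemma fps_linear_ode_unique:
  fixes F G :: "'a::field_char_0 fps"
  assumes "fps_deriv F = A * F" "fps_deriv G = A * G" "fps_nth F 0 = fps_nth G 0"
  shows "F = G"
proof (rule fps_ext)
  fix n show "fps_nth F n = fps_nth G n"
  proof (induction n rule: less_induct)
    case (less n)
    show ?case
    proof (cases n)
      case (Suc m)
      have "of_nat (Suc m) * fps_nth F (Suc m) = (\<Sum>i=0..m. fps_nth A i * fps_nth F (m - i))"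
        using arg_cong[OF assms(1), of "\<lambda>H. fps_nth H m"] by (simp add: fps_mult_nth)
      also have "\<dots> = (\<Sum>i=0..m. fps_nth A i * fps_nth G (m - i))"
        by (intro sum.cong) (auto simp: Suc less)
      also have "\<dots> = of_nat (Suc m) * fps_nth G (Suc m)"
        using arg_cong[OF assms(2), of "\<lambda>H. fps_nth H m"] by (simp add: fps_mult_nth)
      finally show ?thesis by (simp add: Suc del: of_nat_Suc)
    qed (simp add: assms)
  qed
qed

lemma miwa_exp_eqI:
  assumes "fps_deriv F = Abs_fps c * F" "fps_nth F 0 = 1"
  shows "miwa_exp c = F"
  using fps_linear_ode_unique[OF fps_deriv_miwa_exp assms(1)] assms(2) by simp

lemma miwa_exp_add: "miwa_exp (\<lambda>i. a i + b i) = miwa_exp a * miwa_exp b"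
proof (rule miwa_exp_eqI)
  have "Abs_fps (\<lambda>i. a i + b i) = Abs_fps a + Abs_fps b"
    by (simp add: fps_eq_iff)
  then show "fps_deriv (miwa_exp a * miwa_exp b) = Abs_fps (\<lambda>i. a i + b i) * (miwa_exp a * miwa_exp b)"
    by (simp add: fps_deriv_miwa_exp algebra_simps)
qed simp

lemma miwa_exp_0: "miwa_exp (\<lambda>i. 0) = 1"
  by (rule miwa_exp_eqI) (simp_all add: fps_zero_def[symmetric])

lemma miwa_exp_sum: "miwa_exp (\<lambda>i. \<Sum>s\<in>S. f s i) = (\<Prod>s\<in>S. miwa_exp (f s))"
  by (induction S rule: infinite_finite_induct) (simp_all add: miwa_exp_0 miwa_exp_add)

text \<open>This is exp(log(1 - v X)). It turns a power sum in the exponent into a product of linear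
  factors, one for each point.\<close>

lemma miwa_exp_neg_power: "miwa_exp (\<lambda>i. - (v ^ Suc i)) = 1 - fps_const v * fps_X"
proof (rule miwa_exp_eqI)
  have "Abs_fps (\<lambda>i. - (v ^ Suc i)) * (1 - fps_const v * fps_X) = - fps_const v"
  proof (rule fps_ext)
    fix n show "fps_nth (Abs_fps (\<lambda>i. - (v ^ Suc i)) * (1 - fps_const v * fps_X)) n = fps_nth (- fps_const v) n"
      by (cases n) (simp_all add: right_diff_distrib mult.assoc[symmetric])
  qed
  then show "fps_deriv (1 - fps_const v * fps_X) = Abs_fps (\<lambda>i. - (v ^ Suc i)) * (1 - fps_const v * fps_X)"
    by simp
qed simp

lemma exp_linear_add_index:
  "exp_linear c (\<alpha> + \<beta>) * (\<Prod>i\<in>Poly_Mapping.keys \<beta>. of_nat (Poly_Mapping.lookup (\<alpha> + \<beta>) i choose Poly_Mapping.lookup \<beta> i))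
    = exp_linear c \<alpha> * exp_linear c \<beta>"
proof -
  let ?A = "Poly_Mapping.keys \<alpha> \<union> Poly_Mapping.keys \<beta>"
  have "(\<Prod>i\<in>Poly_Mapping.keys \<beta>. of_nat (Poly_Mapping.lookup (\<alpha> + \<beta>) i choose Poly_Mapping.lookup \<beta> i))
      = (\<Prod>i\<in>?A. of_nat (Poly_Mapping.lookup (\<alpha> + \<beta>) i choose Poly_Mapping.lookup \<beta> i) :: 'a)"
    by (rule prod.mono_neutral_left) (auto simp: in_keys_iff)
  moreover have "exp_linear c (\<alpha> + \<beta>) = (\<Prod>i\<in>?A. c i ^ Poly_Mapping.lookup (\<alpha> + \<beta>) i / fact (Poly_Mapping.lookup (\<alpha> + \<beta>) i))"
    by (rule exp_linear_superset) (auto dest: subsetD[OF Poly_Mapping.keys_add])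
  moreover have "exp_linear c \<alpha> = (\<Prod>i\<in>?A. c i ^ Poly_Mapping.lookup \<alpha> i / fact (Poly_Mapping.lookup \<alpha> i))"
     "exp_linear c \<beta> = (\<Prod>i\<in>?A. c i ^ Poly_Mapping.lookup \<beta> i / fact (Poly_Mapping.lookup \<beta> i))"
    by (rule exp_linear_superset; simp)+
  moreover have "x ^ (m + n) / fact (m + n) * of_nat (m + n choose n) = x ^ m / fact m * (x ^ n / fact n)"
    for x :: 'a and m n
    by (subst binomial_fact) (simp_all add: power_add field_simps)
  ultimately show ?thesis
    by (simp add: lookup_add flip: prod.distrib)
qed

text \<open>Shifting the argument of an exponential multiplies it by a factor independent of t: exp
  of the sum of e c_k z^(-k) / k.\<close>

lemma miwa_shift_exp_linear:
  "miwa_shift e (exp_linear c) \<alpha> = fls_const (exp_linear c \<alpha>) * fps_to_fls (miwa_exp (\<lambda>i. e * c i))"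
proof -
  have "exp_linear c (\<alpha> + \<beta>) * (\<Prod>i\<in>Poly_Mapping.keys \<beta>. of_nat (Poly_Mapping.lookup (\<alpha> + \<beta>) i choose Poly_Mapping.lookup \<beta> i)
       * (e / of_nat (Suc i)) ^ Poly_Mapping.lookup \<beta> i)
    = exp_linear c \<alpha> * exp_linear (\<lambda>i. e * c i / of_nat (Suc i)) \<beta>" for \<beta>
  proof -
    have "(\<lambda>i. e * c i / of_nat (Suc i)) = (\<lambda>i. c i * (e / of_nat (Suc i)))" by auto
    then show ?thesis
      unfolding prod.distrib mult.assoc[symmetric] exp_linear_add_index
      by (simp only: exp_linear_scale mult.assoc)
  qed
  then have "miwa_shift e (exp_linear c) \<alpha> = fps_to_fls (fps_const (exp_linear c \<alpha>) * miwa_exp (\<lambda>i. e * c i))"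
    unfolding miwa_shift_def
    by (intro arg_cong[of _ _ fps_to_fls] fps_ext) (simp add: miwa_exp_def sum_distrib_left)
  then show ?thesis by (simp add: fls_times_fps_to_fls)
qed

section \<open>The bilinear form\<close>

text \<open>The polarised residue: with two independent series it is bilinear, so that it can be
  evaluated on pairs of exponentials.\<close>

definition kp_form :: "'a::field_char_0 series \<Rightarrow> 'a series \<Rightarrow> multiindex \<Rightarrow> multiindex \<Rightarrow> 'a" where
  "kp_form \<sigma> \<tau> \<alpha> \<beta> = fls_nth
     (\<Sum>(\<alpha>1, \<alpha>2)\<in>splits \<alpha>. \<Sum>(\<beta>1, \<beta>2)\<in>splits \<beta>.
        exp_linear (\<lambda>i. fls_X_inv ^ Suc i) \<alpha>1 * exp_linear (\<lambda>i. - (fls_X_inv ^ Suc i)) \<beta>1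
        * miwa_shift (-1) \<sigma> \<alpha>2 * miwa_shift 1 \<tau> \<beta>2) 1"

definition miwa_coeff :: "'a::field_char_0 \<Rightarrow> 'a series \<Rightarrow> multiindex \<Rightarrow> nat \<Rightarrow> 'a" where
  "miwa_coeff e \<tau> \<alpha> m = (\<Sum>\<beta> | weight \<beta> = m.
     \<tau> (\<alpha> + \<beta>) * (\<Prod>i\<in>Poly_Mapping.keys \<beta>.
       of_nat (Poly_Mapping.lookup (\<alpha> + \<beta>) i choose Poly_Mapping.lookup \<beta> i)
       * (e / of_nat (Suc i)) ^ Poly_Mapping.lookup \<beta> i))"

lemma miwa_shift_conv_coeff: "miwa_shift e \<tau> \<alpha> = fps_to_fls (Abs_fps (miwa_coeff e \<tau> \<alpha>))"
  by (simp add: miwa_shift_def miwa_coeff_def[abs_def])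

lemma exp_linear_hom:
  assumes "\<And>x y. h (x * y) = h x * h y" "h 1 = 1"
    and "\<And>x y. h (x / y) = h x / h y" "\<And>n. h (of_nat n) = of_nat n"
  shows "exp_linear (\<lambda>i. h (c i)) \<alpha> = h (exp_linear c \<alpha>)"
proof -
  have power: "h (x ^ n) = h x ^ n" for x n by (induction n) (simp_all add: assms)
  have prod: "h (prod f A) = (\<Prod>i\<in>A. h (f i))" for f :: "nat \<Rightarrow> _" and A
    by (induction A rule: infinite_finite_induct) (simp_all add: assms)
  have "h (fact n) = fact n" for n by (metis assms(4) of_nat_fact)
  then show ?thesis by (simp add: exp_linear_def prod power assms)
qed

lemma fls_const_divide: "fls_const (x / y :: 'a::field) = fls_const x / fls_const y"
  by (simp add: divide_inverse fls_inverse_const flip: fls_const_mult_const)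

lemma exp_linear_fls_const: "exp_linear (\<lambda>i. fls_const (c i)) \<alpha> = fls_const (exp_linear c \<alpha>)"
  by (rule exp_linear_hom) (simp_all add: fls_const_divide fls_of_nat)

lemma exp_linear_monomial:
  "exp_linear (\<lambda>i. fls_const e * fls_X_inv ^ Suc i) \<alpha> = fls_const (exp_linear (\<lambda>i. e) \<alpha>) * fls_X_inv ^ weight \<alpha>"
  unfolding exp_linear_scale exp_linear_fls_const
  by (simp only: power_mult[symmetric] weight_def power_sum[symmetric])

lemma fls_const_minus_1: "fls_const (-1) = (-1 :: 'a::ring_1 fls)"
  by (simp add: fls_eq_iff)

lemma fps_to_fls_sum: "fps_to_fls (sum f A) = (\<Sum>a\<in>A. fps_to_fls (f a))"
  by (induction A rule: infinite_finite_induct) simp_all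

lemma fls_nth_X_inv_power_mult: "fls_nth (fls_X_inv ^ k * f) n = fls_nth f (n + int k)"
  by (simp add: fls_X_inv_power_times_conv_shift)

text \<open>The residue without the variable z. The two exponential coefficients contribute z^w,
  where w is the sum of the weights, so the shifted series must contribute z^(-w-1). In this finite
  form bilinearity and the passage between coefficient fields are sums being interchanged.\<close>

lemma kp_form_coeff:
  "kp_form \<sigma> \<tau> \<alpha> \<beta> = (\<Sum>(\<alpha>1, \<alpha>2)\<in>splits \<alpha>. \<Sum>(\<beta>1, \<beta>2)\<in>splits \<beta>.
     exp_linear (\<lambda>i. 1) \<alpha>1 * exp_linear (\<lambda>i. -1) \<beta>1 *
     (\<Sum>m=0..Suc (weight \<alpha>1 + weight \<beta>1).
        miwa_coeff (-1) \<sigma> \<alpha>2 m * miwa_coeff 1 \<tau> \<beta>2 (Suc (weight \<alpha>1 + weight \<beta>1) - m)))"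
proof -
  have "fls_nth (exp_linear (\<lambda>i. fls_X_inv ^ Suc i) \<alpha>1 * exp_linear (\<lambda>i. - (fls_X_inv ^ Suc i)) \<beta>1
        * miwa_shift (-1) \<sigma> \<alpha>2 * miwa_shift 1 \<tau> \<beta>2) 1
     = exp_linear (\<lambda>i. 1) \<alpha>1 * exp_linear (\<lambda>i. -1) \<beta>1 * (\<Sum>m=0..Suc (weight \<alpha>1 + weight \<beta>1).
        miwa_coeff (-1) \<sigma> \<alpha>2 m * miwa_coeff 1 \<tau> \<beta>2 (Suc (weight \<alpha>1 + weight \<beta>1) - m))"
    (is "?l = ?c * ?r") for \<alpha>1 \<alpha>2 \<beta>1 \<beta>2
  proof -
    let ?w = "weight \<alpha>1 + weight \<beta>1"
    let ?A = "Abs_fps (miwa_coeff (-1) \<sigma> \<alpha>2)" and ?B = "Abs_fps (miwa_coeff 1 \<tau> \<beta>2)"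
    have "exp_linear (\<lambda>i. (fls_X_inv :: 'a fls) ^ Suc i) \<alpha>1 = fls_const (exp_linear (\<lambda>i. 1) \<alpha>1) * fls_X_inv ^ weight \<alpha>1"
      using exp_linear_monomial[of "1::'a" \<alpha>1] by (simp only: fls_const_1 mult_1_left)
    moreover have "exp_linear (\<lambda>i. - ((fls_X_inv :: 'a fls) ^ Suc i)) \<beta>1 = fls_const (exp_linear (\<lambda>i. -1) \<beta>1) * fls_X_inv ^ weight \<beta>1"
      using exp_linear_monomial[of "-1::'a" \<beta>1] by (simp only: fls_const_minus_1 mult_minus1)
    ultimately have "?l = fls_nth (fls_const ?c * (fls_X_inv ^ ?w * fps_to_fls (?A * ?B))) 1"
      unfolding miwa_shift_conv_coeff fls_times_fps_to_fls
      by (simp only: power_add fls_const_mult_const[symmetric] mult_ac)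
    also have "\<dots> = ?c * fls_nth (fps_to_fls (?A * ?B)) (1 + int ?w)"
      by (simp only: fls_nth_X_inv_power_mult fls_mult_const_nth)
    also have "fls_nth (fps_to_fls (?A * ?B)) (1 + int ?w) = fps_nth (?A * ?B) (Suc ?w)"
      by (simp add: nat_add_distrib)
    also have "\<dots> = ?r" by (simp add: fps_mult_nth)
    finally show ?thesis .
  qed
  then show ?thesis
    unfolding kp_form_def by (simp add: fls_nth_sum case_prod_unfold)
qed

lemma miwa_coeff_sum:
  "miwa_coeff e (\<lambda>\<alpha>. \<Sum>p\<in>P. k p * f p \<alpha>) \<alpha> m = (\<Sum>p\<in>P. k p * miwa_coeff e (f p) \<alpha> m)"
  unfolding miwa_coeff_def sum_distrib_left sum_distrib_right
  by (subst sum.swap) (simp only: mult.assoc)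

lemma kp_form_sum_left:
  "kp_form (\<lambda>\<alpha>. \<Sum>p\<in>P. k p * f p \<alpha>) \<tau> \<alpha> \<beta> = (\<Sum>p\<in>P. k p * kp_form (f p) \<tau> \<alpha> \<beta>)"
  unfolding kp_form_coeff miwa_coeff_sum case_prod_unfold sum_distrib_left sum_distrib_right
  by (simp only: sum.swap[where B = P] mult_ac)

lemma kp_form_sum_right:
  "kp_form \<sigma> (\<lambda>\<alpha>. \<Sum>p\<in>P. k p * f p \<alpha>) \<alpha> \<beta> = (\<Sum>p\<in>P. k p * kp_form \<sigma> (f p) \<alpha> \<beta>)"
  unfolding kp_form_coeff miwa_coeff_sum case_prod_unfold sum_distrib_left sum_distrib_right
  by (simp only: sum.swap[where B = P] mult_ac)

lemma miwa_coeff_fps_to_fls: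
  "miwa_coeff (fls_const e) (\<lambda>\<alpha>. fps_to_fls (Z \<alpha>)) \<alpha> m
    = fps_to_fls (Abs_fps (\<lambda>k. miwa_coeff e (\<lambda>\<alpha>. fps_nth (Z \<alpha>) k) \<alpha> m))"
proof -
  have *: "of_nat a * (fls_const e / of_nat b) ^ c = fls_const (of_nat a * (e / of_nat b) ^ c)" for a b c
    by (simp only: fls_of_nat fls_const_divide[symmetric] fls_const_power[symmetric] fls_const_mult_const)
  have prod: "(\<Prod>i\<in>I. fls_const (f i)) = fls_const (prod f I)" for f :: "nat \<Rightarrow> 'a" and I
    by (induction I rule: infinite_finite_induct) simp_all
  have "miwa_coeff (fls_const e) (\<lambda>\<alpha>. fps_to_fls (Z \<alpha>)) \<alpha> m
    = (\<Sum>\<beta> | weight \<beta> = m. fps_to_fls (Z (\<alpha> + \<beta>) * fps_const (\<Prod>i\<in>Poly_Mapping.keys \<beta>.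
       of_nat (Poly_Mapping.lookup (\<alpha> + \<beta>) i choose Poly_Mapping.lookup \<beta> i)
       * (e / of_nat (Suc i)) ^ Poly_Mapping.lookup \<beta> i)))"
    unfolding miwa_coeff_def * prod fls_times_fps_to_fls by simp
  also have "\<dots> = fps_to_fls (\<Sum>\<beta> | weight \<beta> = m. Z (\<alpha> + \<beta>) * fps_const (\<Prod>i\<in>Poly_Mapping.keys \<beta>.
       of_nat (Poly_Mapping.lookup (\<alpha> + \<beta>) i choose Poly_Mapping.lookup \<beta> i)
       * (e / of_nat (Suc i)) ^ Poly_Mapping.lookup \<beta> i))"
    by (simp only: fps_to_fls_sum)
  also have "(\<Sum>\<beta> | weight \<beta> = m. Z (\<alpha> + \<beta>) * fps_const (\<Prod>i\<in>Poly_Mapping.keys \<beta>.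
       of_nat (Poly_Mapping.lookup (\<alpha> + \<beta>) i choose Poly_Mapping.lookup \<beta> i)
       * (e / of_nat (Suc i)) ^ Poly_Mapping.lookup \<beta> i))
     = Abs_fps (\<lambda>k. miwa_coeff e (\<lambda>\<alpha>. fps_nth (Z \<alpha>) k) \<alpha> m)"
    by (rule fps_ext) (simp add: fps_sum_nth miwa_coeff_def)
  finally show ?thesis .
qed

text \<open>Here the coefficients are Laurent series in \<Lambda>^2, on top of which
  \<open>kp_form\<close> uses Laurent series in 1/z. The Cauchy product in \<Lambda>^2 removes the
  inner layer and leaves identities over the ground field.\<close>

lemma kp_form_fps_to_fls:
  "kp_form (\<lambda>\<alpha>. fps_to_fls (Y \<alpha>)) (\<lambda>\<alpha>. fps_to_fls (Z \<alpha>)) \<alpha> \<beta>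
    = fps_to_fls (Abs_fps (\<lambda>n. \<Sum>k=0..n. kp_form (\<lambda>\<alpha>. fps_nth (Y \<alpha>) k) (\<lambda>\<alpha>. fps_nth (Z \<alpha>) (n - k)) \<alpha> \<beta>))"
proof -
  let ?A = "\<lambda>\<alpha> m. Abs_fps (\<lambda>k. miwa_coeff (-1) (\<lambda>\<alpha>. fps_nth (Y \<alpha>) k) \<alpha> m)"
  let ?B = "\<lambda>\<alpha> m. Abs_fps (\<lambda>k. miwa_coeff 1 (\<lambda>\<alpha>. fps_nth (Z \<alpha>) k) \<alpha> m)"
  have c: "exp_linear (\<lambda>i. 1) \<gamma> = fps_to_fls (fps_const (exp_linear (\<lambda>i. 1::'a) \<gamma>))"
       "exp_linear (\<lambda>i. -1) \<gamma> = fps_to_fls (fps_const (exp_linear (\<lambda>i. -1::'a) \<gamma>))" for \<gamma>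
    using exp_linear_fls_const[of "\<lambda>i. 1::'a" \<gamma>] exp_linear_fls_const[of "\<lambda>i. -1::'a" \<gamma>]
    by (simp_all add: fls_const_minus_1)
  have m: "miwa_coeff (-1) (\<lambda>\<alpha>. fps_to_fls (Y \<alpha>)) \<gamma> m = fps_to_fls (?A \<gamma> m)"
       "miwa_coeff 1 (\<lambda>\<alpha>. fps_to_fls (Z \<alpha>)) \<gamma> m = fps_to_fls (?B \<gamma> m)" for \<gamma> m
    using miwa_coeff_fps_to_fls[of "-1::'a" Y \<gamma> m] miwa_coeff_fps_to_fls[of "1::'a" Z \<gamma> m]
    by (simp_all add: fls_const_minus_1)
  have "kp_form (\<lambda>\<alpha>. fps_to_fls (Y \<alpha>)) (\<lambda>\<alpha>. fps_to_fls (Z \<alpha>)) \<alpha> \<beta>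
     = fps_to_fls (\<Sum>(\<alpha>1, \<alpha>2)\<in>splits \<alpha>. \<Sum>(\<beta>1, \<beta>2)\<in>splits \<beta>.
     fps_const (exp_linear (\<lambda>i. 1) \<alpha>1) * fps_const (exp_linear (\<lambda>i. -1) \<beta>1) *
     (\<Sum>m=0..Suc (weight \<alpha>1 + weight \<beta>1). ?A \<alpha>2 m * ?B \<beta>2 (Suc (weight \<alpha>1 + weight \<beta>1) - m)))"
    unfolding kp_form_coeff m c case_prod_unfold
    by (simp only: fps_to_fls_sum fls_times_fps_to_fls)
  also have "(\<Sum>(\<alpha>1, \<alpha>2)\<in>splits \<alpha>. \<Sum>(\<beta>1, \<beta>2)\<in>splits \<beta>.
     fps_const (exp_linear (\<lambda>i. 1) \<alpha>1) * fps_const (exp_linear (\<lambda>i. -1) \<beta>1) *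
     (\<Sum>m=0..Suc (weight \<alpha>1 + weight \<beta>1). ?A \<alpha>2 m * ?B \<beta>2 (Suc (weight \<alpha>1 + weight \<beta>1) - m)))
     = Abs_fps (\<lambda>n. \<Sum>k=0..n. kp_form (\<lambda>\<alpha>. fps_nth (Y \<alpha>) k) (\<lambda>\<alpha>. fps_nth (Z \<alpha>) (n - k)) \<alpha> \<beta>)"
    (is "?l = ?r")
  proof (rule fps_ext)
    fix n
    have "fps_nth ?l n = (\<Sum>(\<alpha>1, \<alpha>2)\<in>splits \<alpha>. \<Sum>(\<beta>1, \<beta>2)\<in>splits \<beta>.
     exp_linear (\<lambda>i. 1) \<alpha>1 * exp_linear (\<lambda>i. -1) \<beta>1 *
     (\<Sum>m=0..Suc (weight \<alpha>1 + weight \<beta>1). \<Sum>k=0..n. miwa_coeff (-1) (\<lambda>\<alpha>. fps_nth (Y \<alpha>) k) \<alpha>2 m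
       * miwa_coeff 1 (\<lambda>\<alpha>. fps_nth (Z \<alpha>) (n - k)) \<beta>2 (Suc (weight \<alpha>1 + weight \<beta>1) - m)))"
      unfolding case_prod_unfold
      by (simp only: fps_sum_nth fps_mult_left_const_nth fps_const_mult) (simp only: fps_mult_nth Abs_fps_inverse fps_nth_Abs_fps)
    also have "\<dots> = fps_nth ?r n"
      unfolding kp_form_coeff case_prod_unfold sum_distrib_left fps_nth_Abs_fps
      by (simp only: sum.swap[where B = "{0..n}"])
    finally show "fps_nth ?l n = fps_nth ?r n" .
  qed
  finally show ?thesis .
qed

text \<open>The Miwa factors of exponentials do not depend on the indices, so they leave the sums
  over \<open>splits\<close>; these sums are then products of exponentials.\<close>

lemma kp_form_exp_linear:
  "kp_form (exp_linear c) (exp_linear d) \<alpha> \<beta> = fls_nth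
     (exp_linear (\<lambda>i. fls_X_inv ^ Suc i + fls_const (c i)) \<alpha>
      * exp_linear (\<lambda>i. - (fls_X_inv ^ Suc i) + fls_const (d i)) \<beta>
      * fps_to_fls (miwa_exp (\<lambda>i. - c i) * miwa_exp d)) 1"
proof -
  let ?E = "fps_to_fls (miwa_exp (\<lambda>i. - c i) * miwa_exp d)"
  have "exp_linear (\<lambda>i. fls_X_inv ^ Suc i) \<alpha>1 * exp_linear (\<lambda>i. - (fls_X_inv ^ Suc i)) \<beta>1
        * miwa_shift (-1) (exp_linear c) \<alpha>2 * miwa_shift 1 (exp_linear d) \<beta>2
    = exp_linear (\<lambda>i. fls_X_inv ^ Suc i) \<alpha>1 * exp_linear (\<lambda>i. fls_const (c i)) \<alpha>2
     * (exp_linear (\<lambda>i. - (fls_X_inv ^ Suc i)) \<beta>1 * exp_linear (\<lambda>i. fls_const (d i)) \<beta>2) * ?E" for \<alpha>1 \<alpha>2 \<beta>1 \<beta>2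
    by (simp add: miwa_shift_exp_linear exp_linear_fls_const fls_times_fps_to_fls mult_ac)
  then show ?thesis
    unfolding kp_form_def exp_linear_convolution[symmetric]
    by (simp only: case_prod_unfold sum_product) (simp only: sum_distrib_right)
qed

section \<open>Residues at infinity\<close>

text \<open>The polynomial \<open>p(z)\<close> as a Laurent series in \<open>z\<^sup>-\<^sup>1\<close>.\<close>

definition poly_at_infinity :: "'a::field poly \<Rightarrow> 'a fls" where
  "poly_at_infinity p = poly (map_poly fls_const p) fls_X_inv"

lemma poly_at_infinity_0 [simp]: "poly_at_infinity 0 = 0"
  by (simp add: poly_at_infinity_def)

lemma poly_at_infinity_pCons [simp]:
  "poly_at_infinity (pCons a p) = fls_const a + fls_X_inv * poly_at_infinity p"
  by (simp add: poly_at_infinity_def map_poly_pCons)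

lemma poly_at_infinity_1 [simp]: "poly_at_infinity 1 = 1"
  by (simp add: one_pCons)

lemma poly_at_infinity_add [simp]: "poly_at_infinity (p + q) = poly_at_infinity p + poly_at_infinity q"
  by (induction p q rule: poly_induct2) (simp_all add: algebra_simps flip: fls_plus_const)

lemma poly_at_infinity_smult [simp]: "poly_at_infinity (smult a p) = fls_const a * poly_at_infinity p"
  by (induction p) (simp_all add: algebra_simps flip: fls_const_mult_const)

lemma poly_at_infinity_mult [simp]: "poly_at_infinity (p * q) = poly_at_infinity p * poly_at_infinity q"
  by (induction p) (simp_all add: algebra_simps)

lemma poly_at_infinity_power [simp]: "poly_at_infinity (p ^ n) = poly_at_infinity p ^ n"
  by (induction n) simp_all

lemma poly_at_infinity_prod [simp]: "poly_at_infinity (prod f A) = (\<Prod>a\<in>A. poly_at_infinity (f a))"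
  by (induction A rule: infinite_finite_induct) simp_all

text \<open>As z - v divides p(z) - p(v), replacing p(z) by p(v) in p(z) z / (z - v) changes it by z
  times a polynomial, which is invisible at the positions \<open>m\<close> of z^(-m) with m
  nonnegative.\<close>

lemma poly_at_infinity_geometric:
  "fls_nth (poly_at_infinity p * fps_to_fls (geometric_fps v)) (int m) = v ^ m * poly p v"
proof (induction p arbitrary: m)
  case (pCons a p)
  have "fls_nth (poly_at_infinity (pCons a p) * fps_to_fls (geometric_fps v)) (int m)
    = a * v ^ m + fls_nth (fls_X_inv ^ 1 * (poly_at_infinity p * fps_to_fls (geometric_fps v))) (int m)"
    by (simp add: distrib_right mult.assoc)
  also have "\<dots> = a * v ^ m + v ^ Suc m * poly p v"
    unfolding fls_nth_X_inv_power_mult using pCons.IH[of "Suc m"] by (simp add: add.commute)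
  finally show ?case by (simp add: algebra_simps)
qed simp

text \<open>The residue at infinity of p(z) times the product of (z - a_i) / (z - b_j) is computed
  as the sum of the residues at the simple poles b_j. Equal numbers of factors make the powers of z
  balance.\<close>

lemma residue_at_infinity:
  fixes a :: "'i \<Rightarrow> 'a::field_char_0" and b :: "'j \<Rightarrow> 'a"
  assumes "finite I" "finite J" "card I = card J" "J \<noteq> {}" "inj_on b J"
  shows "fls_nth (poly_at_infinity p * fps_to_fls ((\<Prod>i\<in>I. 1 - fps_const (a i) * fps_X) * (\<Prod>j\<in>J. geometric_fps (b j)))) 1
    = (\<Sum>j\<in>J. poly p (b j) * (\<Prod>i\<in>I. b j - a i) / (\<Prod>k\<in>J-{j}. b j - b k))"
proof -
  let ?c = "\<lambda>j. 1 / (\<Prod>k\<in>J-{j}. b j - b k)"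
  define q where "q = p * (\<Prod>i\<in>I. [:- a i, 1:])"
  have q: "poly q x = poly p x * (\<Prod>i\<in>I. x - a i)" for x
    by (simp add: q_def poly_prod)
  have X: "fls_X * fls_X_inv = (1 :: 'a fls)"
    by (simp add: fls_X_times_conv_shift fls_eq_iff)
  have lin: "fps_to_fls (1 - fps_const (a i) * fps_X) = fls_X * poly_at_infinity [:- a i, 1:]" for i
  proof -
    have "fls_X * poly_at_infinity [:- a i, 1:] = fls_X * fls_const (- a i) + fls_X * fls_X_inv"
      by (simp add: right_diff_distrib)
    also have "fls_const (- a i) = - fls_const (a i)"
      by (simp add: fls_eq_iff)
    finally show ?thesis
      unfolding X by (simp add: fls_times_fps_to_fls mult.commute)
  qed
  have prod_to_fls: "fps_to_fls (prod f A) = (\<Prod>a\<in>A. fps_to_fls (f a))" for f :: "'i \<Rightarrow> 'a fps" and A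
    by (induction A rule: infinite_finite_induct) (simp_all add: fls_times_fps_to_fls)
  \<comment> \<open>One factor X is set apart: the others are those required by
    \<open>fps_partial_fraction\<close>, and the spare one moves the coefficient of interest from
    position 1 to position 0.\<close>
  have card: "card I = Suc (card J - 1)" using assms card_gt_0_iff[of J] by simp
  have "poly_at_infinity p * fps_to_fls ((\<Prod>i\<in>I. 1 - fps_const (a i) * fps_X) * (\<Prod>j\<in>J. geometric_fps (b j)))
    = poly_at_infinity q * fls_X ^ card I * fps_to_fls (\<Prod>j\<in>J. geometric_fps (b j))"
    unfolding q_def fls_times_fps_to_fls prod_to_fls lin by (simp add: prod.distrib mult_ac)
  also have "\<dots> = fls_X * (poly_at_infinity q * fps_to_fls (fps_X ^ (card J - 1) * (\<Prod>j\<in>J. geometric_fps (b j))))"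
    unfolding card by (simp add: fls_times_fps_to_fls fps_to_fls_power mult_ac)
  also have "\<dots> = fls_X * (\<Sum>j\<in>J. fls_const (?c j) * (poly_at_infinity q * fps_to_fls (geometric_fps (b j))))"
    unfolding fps_partial_fraction[OF assms(2,4,5)]
    by (simp add: fls_times_fps_to_fls fps_to_fls_sum sum_distrib_left mult_ac del: fps_const_divide)
  finally have "fls_nth (poly_at_infinity p * fps_to_fls ((\<Prod>i\<in>I. 1 - fps_const (a i) * fps_X) * (\<Prod>j\<in>J. geometric_fps (b j)))) 1
    = (\<Sum>j\<in>J. ?c j * fls_nth (poly_at_infinity q * fps_to_fls (geometric_fps (b j))) (int 0))"
    by (simp add: fls_nth_sum fls_X_times_conv_shift(1))
  also have "\<dots> = (\<Sum>j\<in>J. ?c j * poly q (b j))"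
    unfolding poly_at_infinity_geometric by simp
  finally show ?thesis by (simp add: q)
qed

text \<open>The coefficient at \<alpha> of exp of the sum of (e z^k + c_k) t_k, as a polynomial in
  z: it can be expanded at infinity and also evaluated at the poles.\<close>

definition exp_linear_poly :: "'a::field_char_0 \<Rightarrow> (nat \<Rightarrow> 'a) \<Rightarrow> multiindex \<Rightarrow> 'a poly" where
  "exp_linear_poly e c \<alpha> = (\<Prod>i\<in>Poly_Mapping.keys \<alpha>.
     smult (1 / fact (Poly_Mapping.lookup \<alpha> i)) ((smult e ([:0, 1:] ^ Suc i) + [:c i:]) ^ Poly_Mapping.lookup \<alpha> i))"

lemma poly_exp_linear_poly: "poly (exp_linear_poly e c \<alpha>) v = exp_linear (\<lambda>i. e * v ^ Suc i + c i) \<alpha>"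
  by (simp add: exp_linear_poly_def exp_linear_def poly_prod mult_ac add_ac)

lemma fls_const_fact: "fls_const (fact n :: 'a::field_char_0) = fact n"
  by (metis fls_of_nat of_nat_fact)

lemma poly_at_infinity_exp_linear_poly:
  "poly_at_infinity (exp_linear_poly e c \<alpha>) = exp_linear (\<lambda>i. fls_const e * fls_X_inv ^ Suc i + fls_const (c i)) \<alpha>"
  unfolding exp_linear_poly_def exp_linear_def
  by (simp add: fls_const_divide fls_const_fact del: power_Suc)

text \<open>Power sums in the exponent make the Miwa factor the product of 1 - a_s / z divided by
  that of 1 - b_s / z. The common \<open>r\<close> cancels in it, since \<open>c\<close> enters with
  a minus sign and \<open>d\<close> with a plus sign.\<close>

lemma kp_form_power_sums:
  fixes a :: "'i \<Rightarrow> 'a::field_char_0" and b :: "'j \<Rightarrow> 'a" and r :: "nat \<Rightarrow> 'a"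
  assumes IJ: "finite I" "finite J" "card I = card J" "J \<noteq> {}" "inj_on b J"
  defines "c \<equiv> \<lambda>i. (\<Sum>s\<in>I. a s ^ Suc i) - r i" and "d \<equiv> \<lambda>i. (\<Sum>s\<in>J. b s ^ Suc i) - r i"
  shows "kp_form (exp_linear c) (exp_linear d) \<alpha> \<beta>
    = (\<Sum>j\<in>J. exp_linear (\<lambda>i. b j ^ Suc i + c i) \<alpha> * exp_linear (\<lambda>i. - (b j ^ Suc i) + d i) \<beta>
        * (\<Prod>i\<in>I. b j - a i) / (\<Prod>k\<in>J-{j}. b j - b k))"
proof -
  have geo: "miwa_exp (\<lambda>i. v ^ Suc i) = geometric_fps v" for v :: 'a
  proof -
    have "miwa_exp (\<lambda>i. v ^ Suc i) * (1 - fps_const v * fps_X) = 1"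
      unfolding miwa_exp_neg_power[symmetric] miwa_exp_add[symmetric] by (simp add: miwa_exp_0)
    then have "miwa_exp (\<lambda>i. v ^ Suc i) * (1 - fps_const v * fps_X) * geometric_fps v = geometric_fps v"
      by simp
    then show ?thesis by (simp only: mult.assoc geometric_fps_mult mult_1_right)
  qed
  have "miwa_exp (\<lambda>i. - c i) * miwa_exp d
     = miwa_exp (\<lambda>i. (\<Sum>s\<in>I. - (a s ^ Suc i)) + (\<Sum>s\<in>J. b s ^ Suc i))"
    unfolding miwa_exp_add[symmetric] c_def d_def by (simp add: sum_negf)
  also have "\<dots> = (\<Prod>s\<in>I. 1 - fps_const (a s) * fps_X) * (\<Prod>s\<in>J. geometric_fps (b s))"
    unfolding miwa_exp_add miwa_exp_sum miwa_exp_neg_power geo ..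
  finally have E: "miwa_exp (\<lambda>i. - c i) * miwa_exp d = \<dots>" .
  have "exp_linear (\<lambda>i. fls_X_inv ^ Suc i + fls_const (c i)) \<alpha>
      * exp_linear (\<lambda>i. - (fls_X_inv ^ Suc i) + fls_const (d i)) \<beta>
     = poly_at_infinity (exp_linear_poly 1 c \<alpha> * exp_linear_poly (-1) d \<beta>)"
    by (simp add: poly_at_infinity_exp_linear_poly fls_const_minus_1)
  then have "kp_form (exp_linear c) (exp_linear d) \<alpha> \<beta>
    = fls_nth (poly_at_infinity (exp_linear_poly 1 c \<alpha> * exp_linear_poly (-1) d \<beta>)
       * fps_to_fls ((\<Prod>s\<in>I. 1 - fps_const (a s) * fps_X) * (\<Prod>s\<in>J. geometric_fps (b s)))) 1"
    unfolding kp_form_exp_linear E by simp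
  then show ?thesis
    unfolding residue_at_infinity[OF IJ] by (simp add: poly_exp_linear_poly)
qed

section \<open>The exchange argument\<close>

text \<open>Every pair occurs in both orders, so this is the squared Vandermonde product up to sign,
  without a choice of enumeration of \<open>S\<close>.\<close>

definition difference_product :: "('i \<Rightarrow> 'a::comm_ring_1) \<Rightarrow> 'i set \<Rightarrow> 'a" where
  "difference_product f S = (\<Prod>u\<in>S. \<Prod>v\<in>S-{u}. f u - f v)"

lemma difference_product_insert:
  assumes "finite S" "v \<notin> S"
  shows "difference_product f (insert v S)
    = difference_product f S * (-1) ^ card S * (\<Prod>u\<in>S. f v - f u)\<^sup>2"
proof -
  have "(\<Prod>w\<in>insert v S-{u}. f u - f w) = (f u - f v) * (\<Prod>w\<in>S-{u}. f u - f w)" if "u \<in> S" for u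
  proof -
    have "insert v S - {u} = insert v (S - {u})" using that assms by auto
    then show ?thesis using assms by simp
  qed
  then have "difference_product f (insert v S)
      = (\<Prod>u\<in>S. f v - f u) * ((\<Prod>u\<in>S. f u - f v) * difference_product f S)"
    unfolding difference_product_def using assms
    by (simp add: Diff_insert_absorb prod.distrib cong: prod.cong)
  also have "(\<Prod>u\<in>S. f u - f v) = (\<Prod>u\<in>S. (-1) * (f v - f u))" by simp
  also have "\<dots> = (-1) ^ card S * (\<Prod>u\<in>S. f v - f u)"
    unfolding prod.distrib by simp
  finally show ?thesis by (simp add: power2_eq_square mult_ac)
qed

text \<open>The total \<open>s\<close> encodes the power of \<Lambda>^2. Moving a point between the
  sets preserves it and changes the sizes from (n + 1, n + 1) to (n + 2, n).\<close>

definition subset_pairs :: "nat \<Rightarrow> nat \<Rightarrow> nat \<Rightarrow> (nat set \<times> nat set) set" where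
  "subset_pairs a b s = {(x, y). finite x \<and> finite y \<and> card x = a \<and> card y = b \<and> \<Sum>x + \<Sum>y = s}"

lemma finite_subset_pairs: "finite (subset_pairs a b s)"
proof (rule finite_subset)
  have le: "u \<le> \<Sum>x" if "finite x" "u \<in> x" for u and x :: "nat set"
    using that by (intro member_le_sum[of u x "\<lambda>u. u", simplified]) auto
  show "subset_pairs a b s \<subseteq> Pow {..s} \<times> Pow {..s}"
    by (auto simp: subset_pairs_def dest: le)
qed simp

text \<open>
  Moving \<open>v\<close> from \<open>y\<close> to \<open>x\<close> turns the residues at the points of \<open>y\<close> into a sum, for fixed
  \<open>X = x \<union> {v}\<close> and \<open>Y = y - {v}\<close>, of \<open>\<Prod>u\<in>Y. (f v - f u) / \<Prod>u\<in>X-{v}. (f v - f u)\<close> over \<open>v \<in> X\<close>.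
  This vanishes by Lagrange interpolation, as \<open>card Y < card X - 1\<close>.
\<close>

lemma exchange_sum_eq_0:
  fixes f w :: "nat \<Rightarrow> 'a::field_char_0"
  assumes inj: "inj f"
    and H: "\<And>x y v. finite x \<Longrightarrow> finite y \<Longrightarrow> v \<in> y \<Longrightarrow> v \<notin> x \<Longrightarrow> H x y v = G (insert v x) (y - {v})"
  defines "W \<equiv> \<lambda>S. difference_product f S * (\<Prod>u\<in>S. w u)"
  shows "(\<Sum>(x, y)\<in>subset_pairs (Suc n) (Suc n) s. W x * W y *
      (\<Sum>v\<in>y. H x y v * (\<Prod>u\<in>x. f v - f u) / (\<Prod>u\<in>y-{v}. f v - f u))) = 0"
proof -
  let ?P = "subset_pairs (Suc n) (Suc n) s" and ?Q = "subset_pairs (Suc (Suc n)) n s"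
  let ?t = "\<lambda>x y v. W x * W y * (H x y v * (\<Prod>u\<in>x. f v - f u) / (\<Prod>u\<in>y-{v}. f v - f u))"
  let ?r = "\<lambda>X Y v. - (W X * W Y * (G X Y * ((\<Prod>u\<in>Y. f v - f u) / (\<Prod>u\<in>X-{v}. f v - f u))))"
  \<comment> \<open>With A and B the products of differences of \<open>v\<close> to
    \<open>y - {v}\<close> and \<open>x\<close>, the squares in the weights turn B / A into A / B.
    The minus sign comes from (-1)^(n + 1) for \<open>x\<close> against (-1)^n for
    \<open>y - {v}\<close>.\<close>
  have term_eq: "?r (insert v x) (y - {v}) v = ?t x y v"
    if xy: "(x, y) \<in> ?P" and v: "v \<in> y" "v \<notin> x" for x y v
  proof -
    have fin: "finite x" "finite y" and card: "card x = Suc n" "card (y - {v}) = n"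
      using xy v by (auto simp: subset_pairs_def)
    let ?A = "\<Prod>u\<in>y-{v}. f v - f u" and ?B = "\<Prod>u\<in>x. f v - f u"
    have nz: "?A \<noteq> 0" "?B \<noteq> 0" using fin v inj by (auto simp: inj_eq)
    have "y = insert v (y - {v})" using v by auto
    then have "difference_product f y = difference_product f (y - {v}) * (-1) ^ n * ?A\<^sup>2"
      "prod w y = w v * prod w (y - {v})"
      using difference_product_insert[of "y - {v}" v f] fin card v prod.remove[of y v w] by auto
    moreover have "difference_product f (insert v x) = - (difference_product f x * (-1) ^ n * ?B\<^sup>2)"
      "prod w (insert v x) = w v * prod w x"
      using difference_product_insert[of x v f] fin card v by auto
    moreover have "insert v x - {v} = x" using v by auto
    ultimately show ?thesis
      using nz H[OF fin v] by (simp add: W_def power2_eq_square field_simps)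
  qed
  have "(\<Sum>(x, y)\<in>?P. W x * W y * (\<Sum>v\<in>y. H x y v * (\<Prod>u\<in>x. f v - f u) / (\<Prod>u\<in>y-{v}. f v - f u)))
    = (\<Sum>z\<in>?P. \<Sum>v\<in>snd z. ?t (fst z) (snd z) v)"
    by (simp add: case_prod_unfold sum_distrib_left)
  also have "\<dots> = (\<Sum>(z, v)\<in>(SIGMA z:?P. snd z). ?t (fst z) (snd z) v)"
    by (rule sum.Sigma) (auto simp: finite_subset_pairs, auto simp: subset_pairs_def)
  \<comment> \<open>If \<open>v\<close> already lies in \<open>x\<close>, the numerator contains
    \<open>f v - f v\<close>; only points that can really be moved remain.\<close>
  also have "\<dots> = (\<Sum>(z, v)\<in>(SIGMA z:?P. snd z - fst z). ?t (fst z) (snd z) v)"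
  proof (rule sum.mono_neutral_right)
    show "finite (SIGMA z:?P. snd z)"
      by (rule finite_SigmaI) (auto simp: finite_subset_pairs, auto simp: subset_pairs_def)
    show "\<forall>i\<in>(SIGMA z:?P. snd z) - (SIGMA z:?P. snd z - fst z). (case i of (z, v) \<Rightarrow> ?t (fst z) (snd z) v) = 0"
    proof
      fix i assume "i \<in> (SIGMA z:?P. snd z) - (SIGMA z:?P. snd z - fst z)"
      then obtain x y v where i: "i = ((x, y), v)" and "finite x" "v \<in> x"
        by (auto simp: subset_pairs_def)
      then have "(\<Prod>u\<in>x. f v - f u) = 0" by (intro prod_zero) auto
      then show "(case i of (z, v) \<Rightarrow> ?t (fst z) (snd z) v) = 0" unfolding i by simp
    qed
  qed auto
  also have "\<dots> = (\<Sum>(z, v)\<in>(SIGMA z:?Q. fst z - snd z). ?r (fst z) (snd z) v)"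
  proof -
    let ?j = "\<lambda>((x, y), v). ((insert v x, y - {v}), v)" and ?i = "\<lambda>((X, Y), v). ((X - {v}, insert v Y), v)"
    let ?S = "SIGMA z:?P. snd z - fst z" and ?T = "SIGMA z:?Q. fst z - snd z"
    have j: "?i (?j a) = a" "?j a \<in> ?T"
      "(case ?j a of (z, v) \<Rightarrow> ?r (fst z) (snd z) v) = (case a of (z, v) \<Rightarrow> ?t (fst z) (snd z) v)"
      if "a \<in> ?S" for a
    proof -
      obtain x y v where a: "a = ((x, y), v)" and xy: "(x, y) \<in> ?P" and v: "v \<in> y" "v \<notin> x"
        using \<open>a \<in> ?S\<close> by auto
      have "\<Sum>y = v + \<Sum>(y - {v})" using xy v by (intro sum.remove) (auto simp: subset_pairs_def)
      then have "(insert v x, y - {v}) \<in> ?Q" using xy v by (auto simp: subset_pairs_def)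
      then show "?i (?j a) = a" "?j a \<in> ?T" using a v by auto
      show "(case ?j a of (z, v) \<Rightarrow> ?r (fst z) (snd z) v) = (case a of (z, v) \<Rightarrow> ?t (fst z) (snd z) v)"
        unfolding a prod.case fst_conv snd_conv by (rule term_eq[OF xy v])
    qed
    have i: "?j (?i b) = b" "?i b \<in> ?S" if "b \<in> ?T" for b
    proof -
      obtain X Y v where b: "b = ((X, Y), v)" and XY: "(X, Y) \<in> ?Q" and v: "v \<in> X" "v \<notin> Y"
        using \<open>b \<in> ?T\<close> by auto
      have "\<Sum>X = v + \<Sum>(X - {v})" using XY v by (intro sum.remove) (auto simp: subset_pairs_def)
      then have "(X - {v}, insert v Y) \<in> ?P" using XY v by (auto simp: subset_pairs_def)
      then show "?j (?i b) = b" "?i b \<in> ?S" using b v by auto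
    qed
    show ?thesis by (rule sum.reindex_bij_witness[of ?S ?i ?j ?T]) (erule j i)+
  qed
  \<comment> \<open>The same vanishing in reverse: points common to X and Y are put back, because
    Lagrange interpolation needs the sum over all of X.\<close>
  also have "\<dots> = (\<Sum>(z, v)\<in>(SIGMA z:?Q. fst z). ?r (fst z) (snd z) v)"
  proof (rule sum.mono_neutral_left)
    show "finite (SIGMA z:?Q. fst z)"
      by (rule finite_SigmaI) (auto simp: finite_subset_pairs, auto simp: subset_pairs_def)
    show "\<forall>i\<in>(SIGMA z:?Q. fst z) - (SIGMA z:?Q. fst z - snd z). (case i of (z, v) \<Rightarrow> ?r (fst z) (snd z) v) = 0"
    proof
      fix i assume "i \<in> (SIGMA z:?Q. fst z) - (SIGMA z:?Q. fst z - snd z)"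
      then obtain X Y v where i: "i = ((X, Y), v)" and "finite Y" "v \<in> Y"
        by (auto simp: subset_pairs_def)
      then have "(\<Prod>u\<in>Y. f v - f u) = 0" by (intro prod_zero) auto
      then show "(case i of (z, v) \<Rightarrow> ?r (fst z) (snd z) v) = 0" unfolding i by simp
    qed
  qed auto
  also have "\<dots> = (\<Sum>z\<in>?Q. \<Sum>v\<in>fst z. ?r (fst z) (snd z) v)"
    by (rule sum.Sigma[symmetric]) (auto simp: finite_subset_pairs, auto simp: subset_pairs_def)
  also have "\<dots> = 0"
  proof (rule sum.neutral, rule ballI)
    fix z assume "z \<in> ?Q"
    then have z: "finite (fst z)" "card (fst z) = Suc (Suc n)" "finite (snd z)" "card (snd z) = n"
      by (auto simp: subset_pairs_def)
    define p where "p = (\<Prod>u\<in>snd z. [:- f u, 1:])"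
    have "degree p \<le> n"
      unfolding p_def using degree_prod_sum_le[OF z(3), of "\<lambda>u. [:- f u, 1:]"] z by simp
    then have "(\<Sum>v\<in>fst z. poly p (f v) / (\<Prod>u\<in>fst z-{v}. f v - f u)) = 0"
      using z inj by (intro lagrange_poly_sum) (auto intro: inj_on_subset)
    then have "(\<Sum>v\<in>fst z. (\<Prod>u\<in>snd z. f v - f u) / (\<Prod>u\<in>fst z-{v}. f v - f u)) = 0"
      by (simp add: p_def poly_prod)
    then show "(\<Sum>v\<in>fst z. ?r (fst z) (snd z) v) = 0"
      by (simp only: sum_negf sum_distrib_left[symmetric] mult_zero_right minus_zero)
  qed
  finally show ?thesis .
qed

section \<open>The dimension formula\<close>

definition remove_box :: "(nat \<Rightarrow> nat) \<Rightarrow> nat \<Rightarrow> nat \<Rightarrow> nat" where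
  "remove_box p i = p(i := p i - 1)"

definition corners :: "(nat \<Rightarrow> nat) \<Rightarrow> nat set" where
  "corners p = {i. p (Suc i) < p i}"

lemma partition_antimono: "p \<in> partitions \<Longrightarrow> i \<le> j \<Longrightarrow> p j \<le> p i"
  by (simp add: partitions_def antimono_def)

lemma psize_conv_sum:
  assumes "\<And>i. N \<le> i \<Longrightarrow> p i = 0"
  shows "psize p = (\<Sum>i<N. p i)"
  unfolding psize_def
proof (rule sum.mono_neutral_left)
  show "{i. p i \<noteq> 0} \<subseteq> {..<N}" by (metis (mono_tags) assms lessThan_iff linorder_not_le mem_Collect_eq subsetI)
qed auto

lemma partition_vanishes:
  assumes "p \<in> partitions"
  shows "p (psize p) = 0"
proof (rule ccontr)
  assume nz: "p (psize p) \<noteq> 0"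
  have "{..psize p} \<subseteq> {i. p i \<noteq> 0}"
    using partition_antimono[OF assms, of _ "psize p"] nz by fastforce
  then have "Suc (psize p) \<le> card {i. p i \<noteq> 0}"
    using assms card_mono[of "{i. p i \<noteq> 0}" "{..psize p}"] by (simp add: partitions_def)
  also have "\<dots> = (\<Sum>i | p i \<noteq> 0. 1)" by simp
  also have "\<dots> \<le> psize p" unfolding psize_def by (rule sum_mono) auto
  finally show False by simp
qed

lemma corners_subset:
  assumes "\<And>i. N \<le> i \<Longrightarrow> p i = 0"
  shows "corners p \<subseteq> {..<N}"
proof
  fix i assume "i \<in> corners p"
  then have "p i \<noteq> 0" by (simp add: corners_def)
  then show "i \<in> {..<N}" using assms[of i] by (cases "i < N") auto
qed

lemma remove_box_partition:
  assumes p: "p \<in> partitions" and i: "i \<in> corners p"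
  shows "remove_box p i \<in> partitions"
proof -
  have "remove_box p i b \<le> remove_box p i a" if "a \<le> b" for a b
  proof (cases "a = i \<and> b \<noteq> i")
    case True
    then have "p b \<le> p (Suc i)" using that by (intro partition_antimono[OF p]) auto
    then show ?thesis using True i by (simp add: remove_box_def corners_def)
  next
    case False
    then show ?thesis using partition_antimono[OF p that] by (auto simp: remove_box_def)
  qed
  moreover have "finite {j. remove_box p i j \<noteq> 0}"
    using p by (rule_tac finite_subset[of _ "{j. p j \<noteq> 0}"]) (auto simp: remove_box_def partitions_def)
  ultimately show ?thesis by (auto simp: partitions_def antimono_def)
qed

lemma psize_remove_box:
  assumes p: "p \<in> partitions" and i: "i \<in> corners p"
  shows "psize p = Suc (psize (remove_box p i))"
proof -
  have fin: "finite {j. p j \<noteq> 0}" and pi: "p i \<noteq> 0" using p i by (auto simp: partitions_def corners_def)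
  have "psize (remove_box p i) = (\<Sum>j | p j \<noteq> 0. remove_box p i j)"
    unfolding psize_def using fin by (intro sum.mono_neutral_left) (auto simp: remove_box_def)
  also have "\<dots> = (p i - 1) + (\<Sum>j\<in>{j. p j \<noteq> 0} - {i}. p j)"
    using fin pi by (subst sum.remove[of _ i]) (auto simp: remove_box_def)
  also have "Suc \<dots> = psize p"
    unfolding psize_def using fin pi by (subst (2) sum.remove[of _ i]) auto
  finally show ?thesis by simp
qed

lemma diagram_remove_box:
  "i \<in> corners p \<Longrightarrow> diagram (remove_box p i) = diagram p - {(i, p i - 1)}"
  by (auto simp: diagram_def remove_box_def corners_def split: if_splits)

text \<open>A cell to the right of or below the largest entry would need a larger entry, so the
  largest entry sits at a corner.\<close>

lemma standard_tableaux_remove_max: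
  assumes p: "p \<in> partitions" and T: "T \<in> standard_tableaux p" and c: "c \<in> diagram p" "T c = psize p"
  shows "fst c \<in> corners p" "snd c = p (fst c) - 1" "T(c := 0) \<in> standard_tableaux (remove_box p (fst c))"
proof -
  obtain i j where ij: "c = (i, j)" by (cases c)
  have bij: "bij_betw T (diagram p) {1..psize p}" and out: "\<And>c. c \<notin> diagram p \<Longrightarrow> T c = 0"
    and row: "\<And>i j j'. j < j' \<Longrightarrow> (i, j') \<in> diagram p \<Longrightarrow> T (i, j) < T (i, j')"
    and col: "\<And>i i' j. i < i' \<Longrightarrow> (i', j) \<in> diagram p \<Longrightarrow> T (i, j) < T (i', j)"
    using T by (auto simp: standard_tableaux_def)
  have le: "T d \<le> psize p" if "d \<in> diagram p" for d
    using bij_betwE[OF bij] that by auto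
  have "(i, Suc j) \<notin> diagram p" "(Suc i, j) \<notin> diagram p"
    using row[of j "Suc j" i] col[of i "Suc i" j] le[of "(i, Suc j)"] le[of "(Suc i, j)"] c ij by auto
  then have "p i = Suc j" "p (Suc i) \<le> j"
    using c ij by (auto simp: diagram_def)
  then show corner: "fst c \<in> corners p" and snd: "snd c = p (fst c) - 1"
    using ij by (auto simp: corners_def)
  have size: "psize p = Suc (psize (remove_box p (fst c)))" by (rule psize_remove_box[OF p corner])
  have diag: "diagram (remove_box p (fst c)) = diagram p - {c}"
    using diagram_remove_box[OF corner] snd ij by simp
  have "bij_betw T (diagram p - {c}) ({1..psize p} - {psize p})"
    by (rule bij_betw_DiffI[OF bij]) (use c bij_betwE[OF bij] in auto)
  moreover have "{1..psize p} - {psize p} = {1..psize (remove_box p (fst c))}"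
    unfolding size by auto
  ultimately have "bij_betw (T(c := 0)) (diagram p - {c}) {1..psize (remove_box p (fst c))}"
    by (subst bij_betw_cong[of _ _ T]) auto
  moreover have "(T(c := 0)) (a, b) < (T(c := 0)) (a, b')" if "b < b'" "(a, b') \<in> diagram p - {c}" for a b b'
    using row[of b b' a] that by auto
  moreover have "(T(c := 0)) (a, b) < (T(c := 0)) (a', b)" if "a < a'" "(a', b) \<in> diagram p - {c}" for a a' b
    using col[of a a' b] that by auto
  ultimately show "T(c := 0) \<in> standard_tableaux (remove_box p (fst c))"
    unfolding standard_tableaux_def diag using out by auto
qed

text \<open>The new cell ends its row and, at a corner, has nothing beneath it. It is therefore
  never the smaller side of a row or column comparison.\<close>

lemma standard_tableaux_add_max:
  assumes p: "p \<in> partitions" and i: "i \<in> corners p" and T: "T \<in> standard_tableaux (remove_box p i)"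
  shows "T((i, p i - 1) := psize p) \<in> standard_tableaux p"
proof -
  define c where "c = (i, p i - 1)"
  have c: "c \<in> diagram p" using i by (auto simp: c_def diagram_def corners_def)
  note diag = diagram_remove_box[OF i, folded c_def]
  note size = psize_remove_box[OF p i]
  have bij: "bij_betw T (diagram p - {c}) {1..psize (remove_box p i)}"
    and out: "\<And>c'. c' \<notin> diagram p - {c} \<Longrightarrow> T c' = 0"
    and row: "\<And>i j j'. j < j' \<Longrightarrow> (i, j') \<in> diagram p - {c} \<Longrightarrow> T (i, j) < T (i, j')"
    and col: "\<And>i i' j. i < i' \<Longrightarrow> (i', j) \<in> diagram p - {c} \<Longrightarrow> T (i, j) < T (i', j)"
    using T unfolding standard_tableaux_def diag by auto
  have less: "T d < psize p" if "d \<noteq> c" for d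
    using bij_betwE[OF bij] out[of d] size by (cases "d \<in> diagram p - {c}") force+
  have after: "(a, b) \<noteq> c" if "b < b'" "(a, b') \<in> diagram p" for a b b'
    using that by (auto simp: c_def diagram_def)
  have below: "(a, b) \<noteq> c" if "a < a'" "(a', b) \<in> diagram p" for a a' b
  proof
    assume eq: "(a, b) = c"
    have "p a' \<le> p (Suc i)" using eq that by (intro partition_antimono[OF p]) (auto simp: c_def)
    then show False using eq that i by (auto simp: c_def diagram_def corners_def)
  qed
  have "bij_betw (T(c := psize p)) {c} {psize p}" by simp
  moreover have "bij_betw (T(c := psize p)) (diagram p - {c}) {1..psize (remove_box p i)}"
    using bij by (subst bij_betw_cong[of _ _ T]) auto
  ultimately have "bij_betw (T(c := psize p)) ({c} \<union> (diagram p - {c})) ({psize p} \<union> {1..psize (remove_box p i)})"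
    by (rule bij_betw_combine) (use size in auto)
  then have "bij_betw (T(c := psize p)) (insert c (diagram p - {c})) (insert (psize p) {1..psize (remove_box p i)})"
    by simp
  moreover have "insert c (diagram p - {c}) = diagram p" using c by auto
  moreover have "insert (psize p) {1..psize (remove_box p i)} = {1..psize p}" unfolding size by auto
  ultimately have "bij_betw (T(c := psize p)) (diagram p) {1..psize p}" by simp
  moreover have "(T(c := psize p)) (a, b) < (T(c := psize p)) (a, b')" if "b < b'" "(a, b') \<in> diagram p" for a b b'
    using row[of b b' a] after[OF that] less[of "(a, b)"] that by auto
  moreover have "(T(c := psize p)) (a, b) < (T(c := psize p)) (a', b)" if "a < a'" "(a', b) \<in> diagram p" for a a' b
    using col[of a a' b] below[OF that] less[of "(a, b)"] that by auto
  ultimately show ?thesis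
    unfolding standard_tableaux_def c_def[symmetric] using out c by auto
qed

lemma finite_corners: "p \<in> partitions \<Longrightarrow> finite (corners p)"
  by (rule finite_subset[of _ "{i. p i \<noteq> 0}"]) (auto simp: corners_def partitions_def)

lemma finite_diagram:
  assumes "p \<in> partitions"
  shows "finite (diagram p)"
proof (rule finite_subset)
  show "diagram p \<subseteq> {i. p i \<noteq> 0} \<times> {..<p 0}"
    using partition_antimono[OF assms, of 0] by (force simp: diagram_def intro: less_le_trans)
  show "finite ({i. p i \<noteq> 0} \<times> {..<p 0})" using assms by (simp add: partitions_def)
qed

lemma finite_standard_tableaux:
  assumes "p \<in> partitions"
  shows "finite (standard_tableaux p)"
proof (rule finite_subset)
  show "standard_tableaux p \<subseteq> {T. \<forall>c. (c \<in> diagram p \<longrightarrow> T c \<in> {1..psize p}) \<and> (c \<notin> diagram p \<longrightarrow> T c = 0)}"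
    unfolding standard_tableaux_def bij_betw_def by blast
  show "finite {T. \<forall>c. (c \<in> diagram p \<longrightarrow> T c \<in> {1..psize p}) \<and> (c \<notin> diagram p \<longrightarrow> T c = (0::nat))}"
    by (rule finite_set_of_finite_funs) (simp_all add: finite_diagram[OF assms])
qed

text \<open>Deleting the largest entry while recording its row is a bijection.\<close>

lemma dim_partition_branching:
  assumes p: "p \<in> partitions" and pos: "psize p > 0"
  shows "dim_partition p = (\<Sum>i\<in>corners p. dim_partition (remove_box p i))"
proof -
  let ?S = "SIGMA i:corners p. standard_tableaux (remove_box p i)"
  let ?cell = "\<lambda>T. inv_into (diagram p) T (psize p)"
  let ?f = "\<lambda>T. (fst (?cell T), T(?cell T := 0))"
  let ?g = "\<lambda>(i, T). T((i, p i - 1) := psize p)"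
  have cell: "?cell T \<in> diagram p" "T (?cell T) = psize p" if "T \<in> standard_tableaux p" for T
  proof -
    have "psize p \<in> T ` diagram p" using that pos by (auto simp: standard_tableaux_def bij_betw_def)
    then show "?cell T \<in> diagram p" "T (?cell T) = psize p" by (simp_all add: inv_into_into f_inv_into_f)
  qed
  have "bij_betw ?f (standard_tableaux p) ?S"
  proof (rule bij_betw_byWitness[where f' = ?g])
    show "\<forall>T\<in>standard_tableaux p. ?g (?f T) = T"
    proof
      fix T assume T: "T \<in> standard_tableaux p"
      have "(fst (?cell T), p (fst (?cell T)) - 1) = ?cell T"
        using standard_tableaux_remove_max(2)[OF p T cell[OF T]] by (metis prod.collapse)
      then show "?g (?f T) = T" using cell(2)[OF T] by (simp add: fun_eq_iff)
    qed
    show "\<forall>z\<in>?S. ?f (?g z) = z"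
    proof
      fix z assume "z \<in> ?S"
      then obtain i T where z: "z = (i, T)" and i: "i \<in> corners p" and T: "T \<in> standard_tableaux (remove_box p i)"
        by auto
      let ?c = "(i, p i - 1)" and ?T = "T((i, p i - 1) := psize p)"
      have T': "?T \<in> standard_tableaux p" by (rule standard_tableaux_add_max[OF p i T])
      have "?c \<in> diagram p" using i by (auto simp: diagram_def corners_def)
      moreover have "inj_on ?T (diagram p)" using T' by (auto simp: standard_tableaux_def bij_betw_def)
      ultimately have c: "?cell ?T = ?c"
        using inv_into_f_f[of ?T "diagram p" ?c] by simp
      \<comment> \<open>The added cell lies outside the smaller diagram, where the dummy value is 0;
        resetting it to 0 therefore restores \<open>T\<close> exactly.\<close>
      have "T ?c = 0" using T by (auto simp: standard_tableaux_def diagram_remove_box[OF i])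
      then show "?f (?g z) = z" unfolding z prod.case c by (auto simp: fun_eq_iff)
    qed
    show "?f ` standard_tableaux p \<subseteq> ?S"
    proof
      fix z assume "z \<in> ?f ` standard_tableaux p"
      then obtain T where T: "T \<in> standard_tableaux p" and z: "z = ?f T" by auto
      show "z \<in> ?S"
        unfolding z using standard_tableaux_remove_max(1,3)[OF p T cell[OF T]] by simp
    qed
    show "?g ` ?S \<subseteq> standard_tableaux p"
      using standard_tableaux_add_max[OF p] by auto
  qed
  then have "dim_partition p = card ?S"
    unfolding dim_partition_def by (rule bij_betw_same_card)
  then show ?thesis
    using finite_standard_tableaux[OF remove_box_partition[OF p]] finite_corners[OF p]
    by (simp add: dim_partition_def card_SigmaI)
qed

section \<open>Vandermonde products and the lowering of one variable\<close>

definition vandermonde :: "nat \<Rightarrow> (nat \<Rightarrow> 'a::field) \<Rightarrow> 'a" where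
  "vandermonde N a = (\<Prod>i<N. \<Prod>j\<in>{i<..<N}. a i - a j)"

lemma vandermonde_eq_0:
  assumes "i < j" "j < N" "a i = a j"
  shows "vandermonde N a = 0"
proof -
  have "(\<Prod>k\<in>{i<..<N}. a i - a k) = 0"
    by (rule prod_zero) (use assms in auto)
  moreover have "i \<in> {..<N}" using assms by simp
  ultimately show ?thesis
    unfolding vandermonde_def by (intro prod_zero) blast+
qed

text \<open>The factor 1 - 1 / (a_i - a_j) is the same whether i is the first or the second index of
  the pair: a_j - (a_i - 1) equals a_j - a_i times that factor.\<close>

lemma vandermonde_shift:
  fixes a :: "nat \<Rightarrow> 'a::field"
  assumes inj: "inj_on a {..<N}" and i: "i < N"
  shows "vandermonde N (a(i := a i - 1)) = vandermonde N a * (\<Prod>j\<in>{..<N}-{i}. 1 - 1 / (a i - a j))"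
proof -
  let ?r = "\<lambda>j. 1 - 1 / (a i - a j)"
  let ?R = "\<lambda>j k. if j = i then ?r k else if k = i then ?r j else 1"
  have ne: "a j \<noteq> a k" if "j < k" "k < N" for j k
    using inj_onD[OF inj, of j k] that by auto
  have "vandermonde N (a(i := a i - 1)) = (\<Prod>j<N. \<Prod>k\<in>{j<..<N}. (a j - a k) * ?R j k)"
    unfolding vandermonde_def
  proof (intro prod.cong refl)
    fix j k assume "j \<in> {..<N}" "k \<in> {j<..<N}"
    then have "a j - a k \<noteq> 0" "a k - a j \<noteq> 0" "j \<noteq> k" using ne[of j k] by auto
    then show "(a(i := a i - 1)) j - (a(i := a i - 1)) k = (a j - a k) * ?R j k"
      by (auto simp: field_simps)
  qed
  also have "\<dots> = vandermonde N a * (\<Prod>j<N. \<Prod>k\<in>{j<..<N}. ?R j k)"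
    by (simp add: vandermonde_def prod.distrib)
  also have "(\<Prod>j<N. \<Prod>k\<in>{j<..<N}. ?R j k) = (\<Prod>j<N. if j = i then \<Prod>k\<in>{i<..<N}. ?r k else if j < i then ?r j else 1)"
  proof (intro prod.cong refl)
    fix j assume "j \<in> {..<N}"
    show "(\<Prod>k\<in>{j<..<N}. ?R j k) = (if j = i then \<Prod>k\<in>{i<..<N}. ?r k else if j < i then ?r j else 1)"
    proof (cases "j = i")
      case False
      then have "(\<Prod>k\<in>{j<..<N}. ?R j k) = (\<Prod>k\<in>{j<..<N}. if k = i then ?r j else 1)" by simp
      also have "\<dots> = (if j < i then ?r j else 1)" using i by (subst prod.delta) auto
      finally show ?thesis using False by simp
    qed simp
  qed
  also have "\<dots> = (\<Prod>k\<in>{i<..<N}. ?r k) * (\<Prod>j\<in>{..<N}-{i}. if j < i then ?r j else 1)"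
    using i by (subst prod.remove[of _ i]) (auto intro!: prod.cong)
  also have "(\<Prod>j\<in>{..<N}-{i}. if j < i then ?r j else 1) = (\<Prod>j<i. ?r j)"
    using i by (intro prod.mono_neutral_cong_right) auto
  also have "(\<Prod>k\<in>{i<..<N}. ?r k) * (\<Prod>j<i. ?r j) = (\<Prod>j\<in>{i<..<N} \<union> {..<i}. ?r j)"
    by (rule prod.union_disjoint[symmetric]) auto
  also have "{i<..<N} \<union> {..<i} = {..<N} - {i}" using i by auto
  finally show ?thesis .
qed

text \<open>The product side of the branching rule: for beta numbers, a_i is the quotient of a_i! by
  (a_i - 1)!, and the bracket on the right is the size of the partition.\<close>

lemma sum_vandermonde_shift:
  fixes a :: "nat \<Rightarrow> 'a::field_char_0"
  assumes inj: "inj_on a {..<N}"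
  shows "(\<Sum>i<N. a i * vandermonde N (a(i := a i - 1))) = ((\<Sum>i<N. a i) - of_nat (\<Sum>k<N. k)) * vandermonde N a"
proof -
  have "(\<Sum>i<N. a i * vandermonde N (a(i := a i - 1)))
    = (\<Sum>i<N. a i * (\<Prod>j\<in>{..<N}-{i}. 1 - 1 / (a i - a j))) * vandermonde N a"
    unfolding sum_distrib_right
  proof (rule sum.cong[OF refl])
    fix i assume "i \<in> {..<N}"
    then have "vandermonde N (a(i := a i - 1)) = vandermonde N a * (\<Prod>j\<in>{..<N}-{i}. 1 - 1 / (a i - a j))"
      by (intro vandermonde_shift[OF inj]) simp
    then show "a i * vandermonde N (a(i := a i - 1)) = a i * (\<Prod>j\<in>{..<N}-{i}. 1 - 1 / (a i - a j)) * vandermonde N a"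
      by (simp only: mult_ac)
  qed
  then show ?thesis
    unfolding sum_shifted_ratio(2)[OF finite_lessThan inj] card_lessThan .
qed

section \<open>Beta numbers and the Frobenius formula\<close>

definition beta_number :: "nat \<Rightarrow> (nat \<Rightarrow> nat) \<Rightarrow> nat \<Rightarrow> nat" where
  "beta_number N p i = p i + (N - 1 - i)"

lemma beta_number_strict:
  assumes "p \<in> partitions" "i < j" "j < N"
  shows "beta_number N p j < beta_number N p i"
proof -
  have "p j \<le> p i" using partition_antimono[OF assms(1), of i j] assms(2) by simp
  moreover have "N - 1 - j < N - 1 - i" using assms by linarith
  ultimately show ?thesis unfolding beta_number_def by linarith
qed

lemma inj_on_beta_number: "p \<in> partitions \<Longrightarrow> inj_on (beta_number N p) {..<N}"
  using beta_number_strict by (intro linorder_inj_onI') (metis lessThan_iff less_irrefl)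

lemma sum_beta_number:
  assumes "\<And>i. N \<le> i \<Longrightarrow> p i = 0"
  shows "(\<Sum>i<N. beta_number N p i) = psize p + (\<Sum>k<N. k)"
proof -
  have "(\<Sum>i<N. N - 1 - i) = (\<Sum>k<N. k)"
    using sum.nat_diff_reindex[of "\<lambda>k. k" N] by simp
  then show ?thesis by (simp only: beta_number_def sum.distrib psize_conv_sum[OF assms])
qed

lemma partition_size_0:
  assumes "p \<in> partitions" "psize p = 0"
  shows "p = (\<lambda>i. 0)"
proof
  fix i show "p i = 0"
    using partition_vanishes[OF assms(1)] partition_antimono[OF assms(1), of 0 i] assms(2) by simp
qed

lemma dim_partition_empty: "dim_partition (\<lambda>i. 0) = 1"
proof -
  have "standard_tableaux (\<lambda>i. 0) = {\<lambda>c. 0}"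
    by (auto simp: standard_tableaux_def diagram_def psize_def bij_betw_def)
  then show ?thesis by (simp add: dim_partition_def)
qed

lemma vandermonde_empty:
  "vandermonde N (\<lambda>i. of_nat (N - 1 - i)) = (\<Prod>i<N. fact (N - 1 - i) :: 'a::field_char_0)"
  unfolding vandermonde_def
proof (rule prod.cong[OF refl])
  fix i assume "i \<in> {..<N}"
  have "(\<Prod>j\<in>{i<..<N}. of_nat (N - 1 - i) - of_nat (N - 1 - j)) = (\<Prod>j\<in>{i<..<N}. of_nat (j - i) :: 'a)"
    by (intro prod.cong refl) (auto simp: of_nat_diff)
  also have "\<dots> = (\<Prod>k\<in>{1..N - 1 - i}. of_nat k)"
    by (rule prod.reindex_bij_witness[where i = "\<lambda>k. k + i" and j = "\<lambda>j. j - i"]) auto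
  finally show "(\<Prod>j\<in>{i<..<N}. of_nat (N - 1 - i) - of_nat (N - 1 - j)) = (fact (N - 1 - i) :: 'a)"
    by (simp add: fact_prod)
qed

text \<open>Induction on the size by the branching rule. Removing a box lowers one beta number by 1,
  and non-corners contribute 0 on the product side, so the sum over corners extends to all rows and
  \<open>sum_vandermonde_shift\<close> applies.\<close>

lemma dim_partition_frobenius:
  assumes "p \<in> partitions" "\<And>i. N \<le> i \<Longrightarrow> p i = 0"
  shows "of_nat (dim_partition p) / fact (psize p)
    = (vandermonde N (\<lambda>i. of_nat (beta_number N p i)) / (\<Prod>i<N. fact (beta_number N p i)) :: 'a::field_char_0)"
  using assms
proof (induction "psize p" arbitrary: p)
  case 0
  then have p: "p = (\<lambda>i. 0)" using partition_size_0 by metis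
  then have "beta_number N p = (\<lambda>i. N - 1 - i)" by (auto simp: beta_number_def)
  then show ?case using 0 vandermonde_empty[of N, where 'a = 'a]
    unfolding p by (simp add: dim_partition_empty)
next
  case (Suc n)
  note p = \<open>p \<in> partitions\<close> and zero = \<open>\<And>i. N \<le> i \<Longrightarrow> p i = 0\<close>
  define a :: "nat \<Rightarrow> 'a" where "a = (\<lambda>i. of_nat (beta_number N p i))"
  let ?F = "\<Prod>i<N. fact (beta_number N p i) :: 'a"
  have inj: "inj_on a {..<N}"
    using inj_on_beta_number[OF p, of N] by (auto simp: inj_on_def a_def)
  have branch: "of_nat (dim_partition (remove_box p i)) = fact n * (a i * vandermonde N (a(i := a i - 1)) / ?F)"
    if i: "i \<in> corners p" for i
  proof -
    have iN: "i < N" using corners_subset[of N p] zero i by auto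
    have size: "psize (remove_box p i) = n" using psize_remove_box[OF p i] Suc by simp
    have pos: "p i > 0" using i by (auto simp: corners_def)
    have beta: "beta_number N (remove_box p i) = (beta_number N p)(i := beta_number N p i - 1)"
      using pos by (auto simp: beta_number_def remove_box_def fun_eq_iff)
    have b: "beta_number N p i = Suc (beta_number N p i - 1)" using pos by (simp add: beta_number_def)
    have "of_nat (dim_partition (remove_box p i)) / fact n
       = (vandermonde N (\<lambda>j. of_nat (beta_number N (remove_box p i) j)) / (\<Prod>j<N. fact (beta_number N (remove_box p i) j)) :: 'a)"
      using Suc.hyps(1)[of "remove_box p i"] size remove_box_partition[OF p i] zero
      by (simp add: remove_box_def)
    moreover have "(\<lambda>j. of_nat (beta_number N (remove_box p i) j)) = a(i := a i - 1)"
      unfolding beta a_def using pos by (auto simp: beta_number_def of_nat_diff fun_eq_iff)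
    moreover have "?F = a i * (\<Prod>j<N. fact (beta_number N (remove_box p i) j))"
    proof -
      have "?F = fact (beta_number N p i) * (\<Prod>j\<in>{..<N}-{i}. fact (beta_number N p j))"
        using iN by (intro prod.remove) auto
      also have "fact (beta_number N p i) = a i * (fact (beta_number N p i - 1) :: 'a)"
        unfolding a_def by (subst b) (metis b fact_Suc)
      also have "(\<Prod>j\<in>{..<N}-{i}. fact (beta_number N p j) :: 'a) = (\<Prod>j\<in>{..<N}-{i}. fact (beta_number N (remove_box p i) j))"
        unfolding beta by (intro prod.cong) auto
      also have "fact (beta_number N p i - 1) = (fact (beta_number N (remove_box p i) i) :: 'a)"
        unfolding beta by simp
      finally show ?thesis
        using iN prod.remove[of "{..<N}" i "\<lambda>j. fact (beta_number N (remove_box p i) j) :: 'a"]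
        by (simp add: mult.assoc)
    qed
    moreover have "a i \<noteq> 0" unfolding a_def by (subst b) (simp del: of_nat_Suc)
    ultimately show ?thesis by (simp add: field_simps)
  qed
  \<comment> \<open>Two mechanisms: in the last row a non-corner has beta number 0, and in any other
    row the lowered beta number collides with the next one.\<close>
  have noncorner: "a i * vandermonde N (a(i := a i - 1)) = 0" if i: "i < N" "i \<notin> corners p" for i
  proof (cases "Suc i = N")
    case True
    then have "p i \<le> 0" using i zero[of "Suc i"] by (auto simp: corners_def)
    then show ?thesis using True by (simp add: a_def beta_number_def)
  next
    case False
    then have "Suc i < N" "p i = p (Suc i)"
      using i partition_antimono[OF p, of i "Suc i"] by (auto simp: corners_def)
    then have "beta_number N p i = Suc (beta_number N p (Suc i))"
      by (simp add: beta_number_def)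
    then have "vandermonde N (a(i := a i - 1)) = 0"
      using \<open>Suc i < N\<close> by (intro vandermonde_eq_0[of i "Suc i"]) (auto simp: a_def)
    then show ?thesis by simp
  qed
  have "of_nat (dim_partition p) = (\<Sum>i\<in>corners p. of_nat (dim_partition (remove_box p i)) :: 'a)"
    using dim_partition_branching[OF p] Suc by simp
  also have "\<dots> = (\<Sum>i\<in>corners p. fact n * (a i * vandermonde N (a(i := a i - 1)) / ?F))"
    by (rule sum.cong) (simp_all add: branch)
  also have "\<dots> = fact n * (\<Sum>i\<in>corners p. a i * vandermonde N (a(i := a i - 1))) / ?F"
    by (simp add: sum_distrib_left sum_divide_distrib)
  also have "(\<Sum>i\<in>corners p. a i * vandermonde N (a(i := a i - 1))) = (\<Sum>i<N. a i * vandermonde N (a(i := a i - 1)))"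
    using corners_subset[of N p] zero noncorner by (intro sum.mono_neutral_left) auto
  also have "\<dots> = of_nat (Suc n) * vandermonde N a"
  proof -
    have "(\<Sum>i<N. a i) = of_nat (\<Sum>i<N. beta_number N p i)" by (simp add: a_def)
    also have "\<dots> = of_nat (Suc n) + of_nat (\<Sum>k<N. k)"
      by (simp only: sum_beta_number[OF zero] Suc.hyps(2) of_nat_add)
    finally show ?thesis
      unfolding sum_vandermonde_shift[OF inj] by (simp only: add_diff_cancel_right')
  qed
  finally have "of_nat (dim_partition p) = fact n * (of_nat (Suc n) * vandermonde N a) / ?F" .
  also have "\<dots> = fact (psize p) * (vandermonde N a / ?F)"
    unfolding Suc(2)[symmetric] by (simp add: fact_Suc algebra_simps)
  finally show ?case by (simp add: a_def)
qed

text \<open>The sign is left as an unevaluated product of -1 over the pairs; below only its square,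
  which is 1, is computed.\<close>

lemma vandermonde_square:
  "difference_product a {..<N} = (\<Prod>i<N. \<Prod>j\<in>{i<..<N}. -1) * (vandermonde N a)\<^sup>2"
proof -
  have "difference_product a {..<N} = (\<Prod>i<N. (\<Prod>j\<in>{i<..<N}. a i - a j) * (\<Prod>j<i. a i - a j))"
    unfolding difference_product_def
  proof (rule prod.cong[OF refl])
    fix i assume i: "i \<in> {..<N}"
    then have eq: "{..<N} - {i} = {i<..<N} \<union> {..<i}" by auto
    show "(\<Prod>j\<in>{..<N}-{i}. a i - a j) = (\<Prod>j\<in>{i<..<N}. a i - a j) * (\<Prod>j<i. a i - a j)"
      unfolding eq by (rule prod.union_disjoint) auto
  qed
  also have "\<dots> = vandermonde N a * (\<Prod>i<N. \<Prod>j<i. a i - a j)"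
    by (simp add: prod.distrib vandermonde_def)
  also have "(\<Prod>i<N. \<Prod>j<i. a i - a j) = (\<Prod>(i, j)\<in>(SIGMA i:{..<N}. {..<i}). a i - a j)"
    by (rule prod.Sigma) auto
  also have "\<dots> = (\<Prod>(j, i)\<in>(SIGMA j:{..<N}. {j<..<N}). a i - a j)"
    by (rule prod.reindex_bij_witness[of _ prod.swap prod.swap]) auto
  also have "\<dots> = (\<Prod>j<N. \<Prod>i\<in>{j<..<N}. a i - a j)"
    by (rule prod.Sigma[symmetric]) auto
  also have "\<dots> = (\<Prod>j<N. \<Prod>i\<in>{j<..<N}. (-1) * (a j - a i))" by simp
  also have "\<dots> = (\<Prod>i<N. \<Prod>j\<in>{i<..<N}. -1) * vandermonde N a"
    unfolding prod.distrib vandermonde_def by simp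
  finally show ?thesis by (simp add: power2_eq_square mult_ac)
qed

section \<open>Partitions as finite sets of natural numbers\<close>

definition beta_set :: "nat \<Rightarrow> (nat \<Rightarrow> nat) \<Rightarrow> nat set" where
  "beta_set N p = beta_number N p ` {..<N}"

lemma finite_beta_set [simp]: "finite (beta_set N p)"
  by (simp add: beta_set_def)

lemma card_beta_set: "p \<in> partitions \<Longrightarrow> card (beta_set N p) = N"
  by (simp add: beta_set_def card_image inj_on_beta_number)

lemma sum_beta_set:
  "p \<in> partitions \<Longrightarrow> (\<Sum>u\<in>beta_set N p. g u) = (\<Sum>i<N. g (beta_number N p i))"
  unfolding beta_set_def by (subst sum.reindex) (simp_all add: inj_on_beta_number)

lemma prod_beta_set:
  "p \<in> partitions \<Longrightarrow> (\<Prod>u\<in>beta_set N p. g u) = (\<Prod>i<N. g (beta_number N p i))"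
  unfolding beta_set_def by (subst prod.reindex) (simp_all add: inj_on_beta_number)

lemma sorted_list_of_beta_set:
  assumes "p \<in> partitions"
  shows "sorted_list_of_set (beta_set N p) = rev (map (beta_number N p) [0..<N])"
proof (rule sorted_distinct_set_unique)
  show "sorted (rev (map (beta_number N p) [0..<N]))"
    unfolding sorted_iff_nth_mono
  proof (intro allI impI)
    fix i j assume "i \<le> j" "j < length (rev (map (beta_number N p) [0..<N]))"
    then have ij: "i \<le> j" "j < N" by auto
    have "beta_number N p (N - 1 - i) \<le> beta_number N p (N - 1 - j)"
    proof (cases "i = j")
      case False
      then show ?thesis
        using ij by (intro less_imp_le beta_number_strict[OF assms]) auto
    qed simp
    then show "rev (map (beta_number N p) [0..<N]) ! i \<le> rev (map (beta_number N p) [0..<N]) ! j"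
      using ij by (simp add: rev_nth)
  qed
  show "distinct (rev (map (beta_number N p) [0..<N]))"
    using inj_on_beta_number[OF assms, of N] by (simp add: distinct_map atLeast0LessThan)
qed (auto simp: beta_set_def)

text \<open>The beta numbers are the decreasing enumeration of their set, so the set determines the
  parts.\<close>

lemma inj_on_beta_set: "inj_on (beta_set N) {p \<in> partitions. \<forall>i\<ge>N. p i = 0}"
proof (rule inj_onI, clarify)
  fix p q assume p: "p \<in> partitions" "\<forall>i\<ge>N. p i = 0" and q: "q \<in> partitions" "\<forall>i\<ge>N. q i = 0"
    and "beta_set N p = beta_set N q"
  then have "map (beta_number N p) [0..<N] = map (beta_number N q) [0..<N]"
    using sorted_list_of_beta_set[OF p(1), of N] sorted_list_of_beta_set[OF q(1), of N] by simp
  then have "beta_number N p i = beta_number N q i" if "i < N" for i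
    using that by auto
  then have "p i = q i" if "i < N" for i
    using that unfolding beta_number_def by (metis add_right_cancel)
  then have "p i = q i" for i
    using p q by (cases "i < N") auto
  then show "p = q" by (simp add: fun_eq_iff)
qed

text \<open>In the construction of a partition from a set, this gives the monotonicity of the parts
  and shows that the subtraction on \<open>nat\<close> does not truncate.\<close>

lemma strict_sorted_nth_add:
  fixes xs :: "nat list"
  assumes "sorted xs" "distinct xs" "k + d < length xs"
  shows "xs ! k + d \<le> xs ! (k + d)"
  using assms(3)
proof (induction d)
  case (Suc d)
  have "xs ! (k + d) \<le> xs ! (k + Suc d)" using Suc.prems assms(1) by (intro sorted_nth_mono) auto
  moreover have "xs ! (k + d) \<noteq> xs ! (k + Suc d)" using Suc.prems assms(2) by (simp add: nth_eq_iff_index_eq)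
  ultimately show ?case using Suc by simp
qed simp

lemma beta_set_surj:
  assumes "finite S" "card S = N"
  shows "\<exists>p\<in>partitions. (\<forall>i\<ge>N. p i = 0) \<and> beta_set N p = S"
proof -
  define xs where "xs = sorted_list_of_set S"
  have xs: "sorted xs" "distinct xs" "length xs = N" "set xs = S"
    using assms by (simp_all add: xs_def)
  \<comment> \<open>\<open>xs\<close> is increasing while beta numbers decrease, hence the reversed
    index. The entry at position k is at least k, having k smaller entries before it.\<close>
  define p where "p = (\<lambda>i. if i < N then xs ! (N - 1 - i) - (N - 1 - i) else 0)"
  have anti: "p j \<le> p i" if "i \<le> j" for i j
  proof (cases "j < N")
    case True
    then have "xs ! (N - 1 - j) + (j - i) \<le> xs ! (N - 1 - j + (j - i))"
      using that xs by (intro strict_sorted_nth_add) auto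
    moreover have "N - 1 - j + (j - i) = N - 1 - i" using True that by auto
    ultimately show ?thesis using True that by (simp add: p_def)
  qed (simp add: p_def)
  have p: "p \<in> partitions"
    unfolding partitions_def antimono_def using anti
    by (auto simp: p_def intro: finite_subset[of _ "{..<N}"])
  have "beta_number N p i = xs ! (N - 1 - i)" if "i < N" for i
    using strict_sorted_nth_add[OF xs(1,2), of 0 "N - 1 - i"] that xs(3)
    by (simp add: beta_number_def p_def)
  then have "beta_set N p = (\<lambda>i. xs ! (N - 1 - i)) ` {..<N}"
    unfolding beta_set_def by (intro image_cong) auto
  also have "\<dots> = (!) xs ` {..<N}"
  proof (intro subset_antisym subsetI)
    fix x assume "x \<in> (!) xs ` {..<N}"
    then obtain k where "k < N" "x = xs ! k" by auto
    then show "x \<in> (\<lambda>i. xs ! (N - 1 - i)) ` {..<N}"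
      by (intro image_eqI[of _ _ "N - 1 - k"]) auto
  qed auto
  also have "\<dots> = S" using xs by (auto simp: set_conv_nth)
  finally show ?thesis using p by (intro bexI[of _ p]) (auto simp: p_def)
qed

text \<open>Each beta set has sum |\<lambda>| plus 0 + 1 + ... + (N - 1), which gives the constant
  in the total. Since n < N, every partition of size at most n fits into N rows.\<close>

lemma sum_partition_pairs:
  assumes "n < N"
  shows "(\<Sum>(p, q)\<in>{(p, q). p \<in> partitions \<and> q \<in> partitions \<and> psize p + psize q = n}.
      F (beta_set N p) (beta_set N q)) = (\<Sum>(x, y)\<in>subset_pairs N N (n + 2 * (\<Sum>k<N. k)). F x y)"
proof -
  let ?A = "{(p, q). p \<in> partitions \<and> q \<in> partitions \<and> psize p + psize q = n}"
  let ?P = "{p \<in> partitions. \<forall>i\<ge>N. p i = 0}"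
  have zero: "p i = 0" if "p \<in> partitions" "psize p \<le> n" "N \<le> i" for p i
    using partition_antimono[OF that(1), of "psize p" i] partition_vanishes[OF that(1)] that assms by simp
  have size: "\<Sum>(beta_set N p) = psize p + (\<Sum>k<N. k)" if "p \<in> ?P" for p
    using that sum_beta_number[of N p] by (simp add: sum_beta_set[of p "\<lambda>u. u"])
  have "bij_betw (\<lambda>x. (beta_set N (fst x), beta_set N (snd x))) ?A (subset_pairs N N (n + 2 * (\<Sum>k<N. k)))"
    unfolding bij_betw_def
  proof (intro conjI)
    have "?A \<subseteq> ?P \<times> ?P" using zero by auto
    moreover have "inj_on (\<lambda>x. (beta_set N (fst x), beta_set N (snd x))) (?P \<times> ?P)"
      using inj_on_beta_set[of N] unfolding inj_on_def by auto
    ultimately show "inj_on (\<lambda>x. (beta_set N (fst x), beta_set N (snd x))) ?A"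
      by (rule inj_on_subset[rotated])
    show "(\<lambda>x. (beta_set N (fst x), beta_set N (snd x))) ` ?A = subset_pairs N N (n + 2 * (\<Sum>k<N. k))"
    proof (intro subset_antisym subsetI)
      fix z assume "z \<in> (\<lambda>x. (beta_set N (fst x), beta_set N (snd x))) ` ?A"
      then obtain p q where z: "z = (beta_set N p, beta_set N q)"
        and pq: "p \<in> partitions" "q \<in> partitions" "psize p + psize q = n" by auto
      moreover have "p \<in> ?P" "q \<in> ?P" using pq zero[of p] zero[of q] by auto
      ultimately show "z \<in> subset_pairs N N (n + 2 * (\<Sum>k<N. k))"
        by (simp add: subset_pairs_def card_beta_set size)
    next
      fix z assume "z \<in> subset_pairs N N (n + 2 * (\<Sum>k<N. k))"
      then obtain x y where z: "z = (x, y)" "finite x" "finite y" "card x = N" "card y = N"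
        "\<Sum>x + \<Sum>y = n + 2 * (\<Sum>k<N. k)"
        by (auto simp: subset_pairs_def)
      then obtain p q where "p \<in> ?P" "q \<in> ?P" "beta_set N p = x" "beta_set N q = y"
        using beta_set_surj[of x N] beta_set_surj[of y N] by auto
      then show "z \<in> (\<lambda>x. (beta_set N (fst x), beta_set N (snd x))) ` ?A"
        using size[of p] size[of q] z by (intro image_eqI[of _ _ "(p, q)"]) auto
    qed
  qed
  from sum.reindex_bij_betw[OF this, of "\<lambda>(x, y). F x y"] show ?thesis
    by (simp add: case_prod_unfold)
qed

text \<open>Sends the beta number of row \<open>i\<close> to \<open>p i - i\<close>, the base of the
  powers in \<open>phi4D\<close>.\<close>

definition content_shift :: "nat \<Rightarrow> nat \<Rightarrow> 'a::field_char_0" where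
  "content_shift N u = of_nat u - of_nat (N - 1)"

lemma inj_content_shift: "inj (content_shift N)"
  by (rule injI) (simp add: content_shift_def)

text \<open>The subtracted sum is the same for all partitions with at most N rows. It plays the part
  of \<open>r\<close> in \<open>kp_form_power_sums\<close>.\<close>

lemma phi4D_beta_set:
  assumes p: "p \<in> partitions" "\<And>i. N \<le> i \<Longrightarrow> p i = 0"
  shows "of_int (phi4D k p) = (\<Sum>u\<in>beta_set N p. content_shift N u ^ k) - (\<Sum>i<N. (- of_nat i :: 'a::field_char_0) ^ k)"
proof -
  have "phi4D k p = (\<Sum>i<N. (int (p i) - int i) ^ k - (- int i) ^ k)"
    unfolding phi4D_def
  proof (rule sum.mono_neutral_left)
    show "{i. p i \<noteq> 0} \<subseteq> {..<N}" by (metis (mono_tags) p(2) lessThan_iff linorder_not_le mem_Collect_eq subsetI)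
  qed auto
  moreover have "of_nat (p i) - of_nat i = (content_shift N (beta_number N p i) :: 'a)" if "i < N" for i
    using that by (simp add: content_shift_def beta_number_def of_nat_diff)
  ultimately show ?thesis
    by (simp add: sum_beta_set[OF p(1)] sum_subtractf)
qed

lemma dim_partition_square:
  assumes p: "p \<in> partitions" "\<And>i. N \<le> i \<Longrightarrow> p i = 0"
  shows "(of_nat (dim_partition p) / fact (psize p))\<^sup>2
    = (\<Prod>i<N. \<Prod>j\<in>{i<..<N}. -1) * (difference_product (content_shift N) (beta_set N p)
        * (\<Prod>u\<in>beta_set N p. 1 / (fact u)\<^sup>2) :: 'a::field_char_0)"
proof -
  let ?a = "\<lambda>i. of_nat (beta_number N p i) :: 'a" and ?e = "\<Prod>i<N. \<Prod>j\<in>{i<..<N}. -1 :: 'a"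
  note inj = inj_on_beta_number[OF p(1), of N]
  have "difference_product (content_shift N) (beta_set N p) = difference_product ?a {..<N}"
  proof -
    have inner: "(\<Prod>v\<in>beta_set N p - {beta_number N p i}. content_shift N (beta_number N p i) - content_shift N v)
       = (\<Prod>j\<in>{..<N}-{i}. ?a i - ?a j)" if "i < N" for i
    proof -
      have "beta_set N p - {beta_number N p i} = beta_number N p ` ({..<N} - {i})"
        unfolding beta_set_def using inj_on_image_set_diff[OF inj, of "{..<N}" "{i}"] that by auto
      moreover have "inj_on (beta_number N p) ({..<N} - {i})"
        using inj by (rule inj_on_subset) auto
      ultimately show ?thesis
        by (simp add: prod.reindex content_shift_def)
    qed
    show ?thesis
      unfolding difference_product_def prod_beta_set[OF p(1)] by (rule prod.cong[OF refl], rule inner, simp)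
  qed
  then have D: "difference_product (content_shift N) (beta_set N p) = ?e * (vandermonde N ?a)\<^sup>2"
    by (simp only: vandermonde_square)
  have "?e * ?e = (\<Prod>i<N. \<Prod>j\<in>{i<..<N}. (-1) * (-1))"
    by (simp only: prod.distrib)
  then have e: "?e * ?e = 1" by simp
  have "(of_nat (dim_partition p) / fact (psize p))\<^sup>2
      = (?e * ?e) * ((vandermonde N ?a)\<^sup>2 * (\<Prod>u\<in>beta_set N p. 1 / (fact u)\<^sup>2))"
    unfolding e prod_beta_set[OF p(1)] using dim_partition_frobenius[OF p, where 'a = 'a]
    by (simp only: power_divide prod_dividef prod_power_distrib power_one prod.neutral_const times_divide_eq_right mult_1_left mult_1_right)
  then show ?thesis unfolding D by (simp only: mult.assoc)
qed

section \<open>The bilinear identity\<close>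

definition Z4D_level :: "'a::field_char_0 \<Rightarrow> nat \<Rightarrow> 'a series" where
  "Z4D_level h n \<alpha> = (\<Sum>p | p \<in> partitions \<and> psize p = n.
     ((of_nat (dim_partition p) / fact (psize p))\<^sup>2 * (1 / h\<^sup>2) ^ n)
       * exp_linear (\<lambda>i. of_int (phi4D (Suc i) p)) \<alpha>)"

lemma Z4D_nth_eq_level: "fps_nth (Z4D h \<alpha>) n = Z4D_level h n \<alpha>"
  unfolding Z4D_nth Z4D_level_def
proof (rule sum.cong[OF refl], clarify)
  fix p assume "n = psize p"
  then show "fps_nth (Z4D_term h p \<alpha>) (psize p) = (of_nat (dim_partition p) / fact (psize p))\<^sup>2 * (1 / h\<^sup>2) ^ psize p
       * exp_linear (\<lambda>i. of_int (phi4D (Suc i) p)) \<alpha>"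
    by (simp add: Z4D_term_def power_mult_distrib fps_const_power mult.assoc fps_X_power_mult_nth del: fps_const_divide)
qed

lemma kp_form_Z4D_level: "(\<Sum>k=0..n. kp_form (Z4D_level h k) (Z4D_level h (n - k)) \<alpha> \<beta>) = (0 :: 'a::field_char_0)"
proof -
  \<comment> \<open>Partitions of size at most n have at most n rows; the successor keeps the point
    sets nonempty also for n = 0.\<close>
  define N where "N = Suc n"
  let ?s = "content_shift N :: nat \<Rightarrow> 'a"
  define w :: "nat \<Rightarrow> 'a" where "w u = 1 / (fact u)\<^sup>2" for u
  define e :: 'a where "e = (\<Prod>i<N. \<Prod>j\<in>{i<..<N}. -1)"
  define W where "W S = difference_product ?s S * (\<Prod>u\<in>S. w u)" for S
  define r where "r i = (\<Sum>j<N. (- of_nat j :: 'a) ^ Suc i)" for i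
  define c where "c S i = (\<Sum>u\<in>S. ?s u ^ Suc i) - r i" for S :: "nat set" and i
  let ?K = "\<lambda>p. (of_nat (dim_partition p) / fact (psize p))\<^sup>2 :: 'a"
  let ?\<phi> = "\<lambda>p i. of_int (phi4D (Suc i) p) :: 'a"
  let ?Q = "\<lambda>k. {p. p \<in> partitions \<and> psize p = k}"
  let ?A = "{(p, q). p \<in> partitions \<and> q \<in> partitions \<and> psize p + psize q = n}"
  have zero: "p i = 0" if "p \<in> partitions" "psize p \<le> n" "N \<le> i" for p i
    using partition_antimono[OF that(1), of "psize p" i] partition_vanishes[OF that(1)] that by (simp add: N_def)
  have finQ: "finite (?Q k)" for k using finite_partitions_of[of k] by simp
  have level: "Z4D_level h k = (\<lambda>\<alpha>. \<Sum>p\<in>?Q k. (?K p * (1 / h\<^sup>2) ^ k) * exp_linear (?\<phi> p) \<alpha>)" for k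
    by (simp add: Z4D_level_def fun_eq_iff)
  have "(\<Sum>k=0..n. kp_form (Z4D_level h k) (Z4D_level h (n - k)) \<alpha> \<beta>)
    = (\<Sum>k=0..n. \<Sum>p\<in>?Q k. \<Sum>q\<in>?Q (n - k). (1 / h\<^sup>2) ^ n * (?K p * ?K q * kp_form (exp_linear (?\<phi> p)) (exp_linear (?\<phi> q)) \<alpha> \<beta>))"
  proof (rule sum.cong[OF refl])
    fix k assume "k \<in> {0..n}"
    \<comment> \<open>The two sizes add up to n, so the powers of hbar combine into one common
      factor.\<close>
    then have pw: "(1 / h\<^sup>2) ^ n = (1 / h\<^sup>2) ^ k * (1 / h\<^sup>2) ^ (n - k)" by (simp flip: power_add)
    show "kp_form (Z4D_level h k) (Z4D_level h (n - k)) \<alpha> \<beta>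
      = (\<Sum>p\<in>?Q k. \<Sum>q\<in>?Q (n - k). (1 / h\<^sup>2) ^ n * (?K p * ?K q * kp_form (exp_linear (?\<phi> p)) (exp_linear (?\<phi> q)) \<alpha> \<beta>))"
      unfolding level kp_form_sum_left kp_form_sum_right sum_distrib_left pw by (simp only: mult_ac)
  qed
  also have "\<dots> = (1 / h\<^sup>2) ^ n * (\<Sum>k=0..n. \<Sum>p\<in>?Q k. \<Sum>q\<in>?Q (n - k). ?K p * ?K q * kp_form (exp_linear (?\<phi> p)) (exp_linear (?\<phi> q)) \<alpha> \<beta>)"
    by (simp only: sum_distrib_left)
  also have "(\<Sum>k=0..n. \<Sum>p\<in>?Q k. \<Sum>q\<in>?Q (n - k). ?K p * ?K q * kp_form (exp_linear (?\<phi> p)) (exp_linear (?\<phi> q)) \<alpha> \<beta>)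
    = (\<Sum>(k, p, q)\<in>(SIGMA k:{0..n}. ?Q k \<times> ?Q (n - k)). ?K p * ?K q * kp_form (exp_linear (?\<phi> p)) (exp_linear (?\<phi> q)) \<alpha> \<beta>)"
    unfolding sum.cartesian_product by (rule sum.Sigma) (auto simp: finQ)
  also have "\<dots> = (\<Sum>(p, q)\<in>?A. ?K p * ?K q * kp_form (exp_linear (?\<phi> p)) (exp_linear (?\<phi> q)) \<alpha> \<beta>)"
    by (rule sum.reindex_bij_witness[where j = "\<lambda>(k, p, q). (p, q)" and i = "\<lambda>(p, q). (psize p, p, q)"]) auto
  also have "\<dots> = (\<Sum>(p, q)\<in>?A. (e * W (beta_set N p)) * (e * W (beta_set N q))
      * kp_form (exp_linear (c (beta_set N p))) (exp_linear (c (beta_set N q))) \<alpha> \<beta>)"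
  proof (rule sum.cong[OF refl])
    fix z assume "z \<in> ?A"
    then obtain p q where z: "z = (p, q)" and pq: "p \<in> partitions" "q \<in> partitions" "psize p \<le> n" "psize q \<le> n" by auto
    have K: "?K p' = e * W (beta_set N p')" and \<phi>: "?\<phi> p' = c (beta_set N p')"
      if "p' \<in> partitions" "psize p' \<le> n" for p'
      using dim_partition_square[OF that(1) zero[OF that], where 'a = 'a]
        phi4D_beta_set[OF that(1) zero[OF that], where 'a = 'a]
      by (simp_all add: e_def W_def w_def c_def r_def fun_eq_iff)
    show "(case z of (p, q) \<Rightarrow> ?K p * ?K q * kp_form (exp_linear (?\<phi> p)) (exp_linear (?\<phi> q)) \<alpha> \<beta>)
      = (case z of (p, q) \<Rightarrow> (e * W (beta_set N p)) * (e * W (beta_set N q))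
        * kp_form (exp_linear (c (beta_set N p))) (exp_linear (c (beta_set N q))) \<alpha> \<beta>)"
      unfolding z prod.case K[OF pq(1,3)] K[OF pq(2,4)] \<phi>[OF pq(1,3)] \<phi>[OF pq(2,4)] ..
  qed
  also have "\<dots> = (\<Sum>(x, y)\<in>subset_pairs N N (n + 2 * (\<Sum>k<N. k)). (e * W x) * (e * W y)
      * kp_form (exp_linear (c x)) (exp_linear (c y)) \<alpha> \<beta>)"
    by (rule sum_partition_pairs) (simp add: N_def)
  also have "\<dots> = e * e * (\<Sum>(x, y)\<in>subset_pairs N N (n + 2 * (\<Sum>k<N. k)). W x * W y
      * (\<Sum>v\<in>y. (exp_linear (\<lambda>i. ?s v ^ Suc i + c x i) \<alpha> * exp_linear (\<lambda>i. - (?s v ^ Suc i) + c y i) \<beta>)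
        * (\<Prod>u\<in>x. ?s v - ?s u) / (\<Prod>u\<in>y-{v}. ?s v - ?s u)))"
    unfolding sum_distrib_left[of "e * e"]
  proof (rule sum.cong[OF refl], clarify)
    fix x y assume "(x, y) \<in> subset_pairs N N (n + 2 * (\<Sum>k<N. k))"
    then have xy: "finite x" "finite y" "card x = card y" "y \<noteq> {}"
      by (auto simp: subset_pairs_def N_def)
    have "kp_form (exp_linear (c x)) (exp_linear (c y)) \<alpha> \<beta>
      = (\<Sum>v\<in>y. (exp_linear (\<lambda>i. ?s v ^ Suc i + c x i) \<alpha> * exp_linear (\<lambda>i. - (?s v ^ Suc i) + c y i) \<beta>)
        * (\<Prod>u\<in>x. ?s v - ?s u) / (\<Prod>u\<in>y-{v}. ?s v - ?s u))"
      unfolding c_def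
      by (rule kp_form_power_sums[OF xy]) (rule inj_on_subset[OF inj_content_shift subset_UNIV])
    then show "(e * W x) * (e * W y) * kp_form (exp_linear (c x)) (exp_linear (c y)) \<alpha> \<beta>
      = e * e * (W x * W y * (\<Sum>v\<in>y. (exp_linear (\<lambda>i. ?s v ^ Suc i + c x i) \<alpha> * exp_linear (\<lambda>i. - (?s v ^ Suc i) + c y i) \<beta>)
        * (\<Prod>u\<in>x. ?s v - ?s u) / (\<Prod>u\<in>y-{v}. ?s v - ?s u)))"
      by (simp only: mult_ac)
  qed
  also have "(\<Sum>(x, y)\<in>subset_pairs N N (n + 2 * (\<Sum>k<N. k)). W x * W y
      * (\<Sum>v\<in>y. (exp_linear (\<lambda>i. ?s v ^ Suc i + c x i) \<alpha> * exp_linear (\<lambda>i. - (?s v ^ Suc i) + c y i) \<beta>)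
        * (\<Prod>u\<in>x. ?s v - ?s u) / (\<Prod>u\<in>y-{v}. ?s v - ?s u))) = 0"
    unfolding W_def N_def
  proof (rule exchange_sum_eq_0[where G = "\<lambda>X Y. exp_linear (c X) \<alpha> * exp_linear (c Y) \<beta>"])
    \<comment> \<open>At the pole of \<open>v\<close>, the powers of z are those of the point of
      \<open>v\<close>: they complete the power sums of \<open>x\<close> and cancel the term of
      \<open>v\<close> in those of \<open>y\<close>. This is the required dependence on the
      exchanged pair alone.\<close>
    fix x y :: "nat set" and v assume xy: "finite x" "finite y" "v \<in> y" "v \<notin> x"
    then have "content_shift (Suc n) v ^ Suc i + c x i = c (insert v x) i"
      "- (content_shift (Suc n) v ^ Suc i) + c y i = c (y - {v}) i" for i
      unfolding c_def N_def using sum.remove[of y v "\<lambda>u. content_shift (Suc n) u ^ Suc i :: 'a"] by simp_all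
    then show "exp_linear (\<lambda>i. content_shift (Suc n) v ^ Suc i + c x i) \<alpha> * exp_linear (\<lambda>i. - (content_shift (Suc n) v ^ Suc i) + c y i) \<beta>
      = exp_linear (c (insert v x)) \<alpha> * exp_linear (c (y - {v})) \<beta>" by presburger
  qed (rule inj_content_shift)
  finally show ?thesis by simp
qed

theorem theorem8:
  fixes hbar :: "'a::field_char_0"
  assumes "hbar \<noteq> 0"
  shows "kp_tau (\<lambda>\<alpha>. fps_to_fls (Z4D hbar \<alpha>))"
  unfolding kp_tau_def
proof
  have "{p. p \<in> partitions \<and> psize p = 0} = {\<lambda>i. 0}"
  proof (rule subset_antisym)
    show "{p. p \<in> partitions \<and> psize p = 0} \<subseteq> {\<lambda>i. 0}"
      by (blast intro: partition_size_0)
    show "{\<lambda>i. 0} \<subseteq> {p. p \<in> partitions \<and> psize p = 0}"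
      by (simp add: partitions_def psize_def antimono_def)
  qed
  \<comment> \<open>The empty partition alone contributes to the constant term, which witnesses that
    the series is nonzero.\<close>
  then have "fps_nth (Z4D hbar 0) 0 = 1"
    unfolding Z4D_nth_eq_level Z4D_level_def by (simp add: dim_partition_empty psize_def)
  then have "fps_to_fls (Z4D hbar 0) \<noteq> 0" by auto
  then show "\<exists>\<alpha>. fps_to_fls (Z4D hbar \<alpha>) \<noteq> 0" by (rule exI)
next
  have "fls_nth (kp_integrand (\<lambda>\<alpha>. fps_to_fls (Z4D hbar \<alpha>)) \<alpha> \<beta>) 1 = 0" for \<alpha> \<beta>
  proof -
    have "fls_nth (kp_integrand (\<lambda>\<alpha>. fps_to_fls (Z4D hbar \<alpha>)) \<alpha> \<beta>) 1
      = kp_form (\<lambda>\<alpha>. fps_to_fls (Z4D hbar \<alpha>)) (\<lambda>\<alpha>. fps_to_fls (Z4D hbar \<alpha>)) \<alpha> \<beta>"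
      by (simp only: kp_integrand_def kp_form_def)
    also have "\<dots> = 0"
      unfolding kp_form_fps_to_fls Z4D_nth_eq_level kp_form_Z4D_level by (simp add: fps_zero_def[symmetric])
    finally show ?thesis .
  qed
  then show "\<forall>\<alpha> \<beta>. fls_nth (kp_integrand (\<lambda>\<alpha>. fps_to_fls (Z4D hbar \<alpha>)) \<alpha> \<beta>) 1 = 0" by blast
qed

end
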